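(* Let $f(z)=z+a_1z^{k+1}+a_2z^{k+2}+o(z^{k+2})$, $k\in\mathbb{N}$, $a_1\neq0$, be a parabolic germ and let $\varepsilon>0$. The function $z\mapsto A^{\mathbb{C}}(z,\varepsilon)$ is not analytic on any attracting petal $V_+$ of $f$. The function $z\mapsto A^{\mathbb{C},f^{\circ -1}}(z,\varepsilon)$ is not analytic on any repelling petal $V_-$ of $f$.
   Context: An attracting petal $V_+$ of $f$ is a domain accumulating at $0$, $f$-invariant, bisected by an attracting direction (normalized $(-a_1)^{-1/k}$) and tangent at $0$ to the two neighbouring repelling directions (normalized $a_1^{-1/k}$), on which orbits of $f$ converge to $0$. A repelling petal $V_-$ of $f$ is an attracting petal of $f^{\circ -1}$. For $z\in V_+$ let $S^f(z)=\{f^{\circ n}(z):n\ge0\}$ be the orbit, $S^f(z)_\varepsilon$ its $\varepsilon$-neighborhood, $A(S^f(z)_\varepsilon)$ the area and $t_{S^f(z)_\varepsilon}\in\mathbb{C}$ the center of mass of this set. The directed area is $A^{\mathbb{C}}(z,\varepsilon)=A(S^f(z)_\varepsilon)\cdot t_{S^f(z)_\varepsilon}$. For $z\in V_-$, $A^{\mathbb{C},f^{\circ-1}}(z,\varepsilon)$ is the directed area defined in the same way for the orbit $S^{f^{\circ -1}}(z)$ of $f^{\circ -1}$. "Analytic" means holomorphic as a complex function of $z$. *)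

theory Defs
  imports "HOL-Complex_Analysis.Complex_Analysis" "HOL-Library.Landau_Symbols"
begin

text \<open>
  A germ at 0 is represented by a total function that is holomorphic on an open neighbourhood
  \<open>U\<close> of 0; its values outside \<open>U\<close> carry no information, so petals are required to lie in \<open>U\<close>.
\<close>

definition germ_on :: "complex set \<Rightarrow> (complex \<Rightarrow> complex) \<Rightarrow> bool" where
  "germ_on U f \<longleftrightarrow> open U \<and> 0 \<in> U \<and> f holomorphic_on U"

text \<open>At most one pair \<open>k\<close>, \<open>a\<close> satisfies the following for a given \<open>f\<close>.\<close>

definition parabolic_leading_term :: "(complex \<Rightarrow> complex) \<Rightarrow> nat \<Rightarrow> complex \<Rightarrow> bool" where
  "parabolic_leading_term f k a \<longleftrightarrow>
     k \<ge> 1 \<and> a \<noteq> 0 \<and> (\<lambda>z. f z - (z + a * z ^ (k + 1))) \<in> o[at 0](\<lambda>z. z ^ (k + 1))"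

definition sector :: "complex \<Rightarrow> real \<Rightarrow> real \<Rightarrow> complex set" where
  "sector v \<alpha> r = {z. 0 < norm z \<and> norm z < r \<and> \<bar>Arg (z / v)\<bar> < \<alpha>}"

text \<open>
  The attracting directions, normalized as \<open>(-a)\<close> to the power \<open>-1/k\<close>, are the \<open>v\<close> with
  \<open>a * v ^ k = -1\<close>.  The two repelling directions next to \<open>v\<close> are \<open>v * cis (pi/k)\<close> and
  \<open>v * cis (-pi/k)\<close> (they coincide if \<open>k = 1\<close>).  That \<open>V\<close> is bisected by \<open>v\<close> and tangent at 0 to
  these two directions means that, near 0, \<open>V\<close> contains every smaller sector and is contained in
  every larger sector around \<open>v\<close>; for \<open>k = 1\<close> the larger sectors are full punctured discs.
\<close>

definition attracting_petal :: "complex set \<Rightarrow> (complex \<Rightarrow> complex) \<Rightarrow> complex set \<Rightarrow> bool" where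
  "attracting_petal U f V \<longleftrightarrow>
     open V \<and> connected V \<and> V \<subseteq> U \<and> 0 islimpt V \<and> f ` V \<subseteq> V \<and>
     (\<forall>z\<in>V. (\<lambda>n. (f ^^ n) z) \<longlonglongrightarrow> 0) \<and>
     (\<exists>k a v. parabolic_leading_term f k a \<and> a * v ^ k = -1 \<and>
        (\<forall>\<delta>. 0 < \<delta> \<and> \<delta> < pi / real k \<longrightarrow>
           (\<exists>r>0. sector v (pi / real k - \<delta>) r \<subseteq> V)) \<and>
        (\<forall>\<delta>>0. \<exists>r>0. V \<inter> ball 0 r - {0} \<subseteq> sector v (pi / real k + \<delta>) r))"

definition inverse_germ_on ::
  "complex set \<Rightarrow> (complex \<Rightarrow> complex) \<Rightarrow> (complex \<Rightarrow> complex) \<Rightarrow> bool" where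
  "inverse_germ_on W g f \<longleftrightarrow>
     germ_on W g \<and> (\<forall>\<^sub>F z in nhds 0. f (g z) = z) \<and> (\<forall>\<^sub>F z in nhds 0. g (f z) = z)"

text \<open>\<open>g\<close>, holomorphic on \<open>W\<close>, is the representative of the inverse germ of \<open>f\<close> being iterated.\<close>

definition repelling_petal ::
  "complex set \<Rightarrow> (complex \<Rightarrow> complex) \<Rightarrow> (complex \<Rightarrow> complex) \<Rightarrow> complex set \<Rightarrow> bool" where
  "repelling_petal W g f V \<longleftrightarrow> inverse_germ_on W g f \<and> attracting_petal W g V"

definition orbit_of :: "(complex \<Rightarrow> complex) \<Rightarrow> complex \<Rightarrow> complex set" where
  "orbit_of f z = {(f ^^ n) z | n. True}"

definition eps_nbhd :: "real \<Rightarrow> complex set \<Rightarrow> complex set" where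
  "eps_nbhd \<epsilon> S = (\<Union>s\<in>S. ball s \<epsilon>)"

definition area :: "complex set \<Rightarrow> real" where
  "area S = measure lborel S"

definition center_of_mass :: "complex set \<Rightarrow> complex" where
  "center_of_mass S = (LINT w:S|lborel. w) / complex_of_real (area S)"

definition directed_area :: "(complex \<Rightarrow> complex) \<Rightarrow> real \<Rightarrow> complex \<Rightarrow> complex" where
  "directed_area f \<epsilon> z =
     complex_of_real (area (eps_nbhd \<epsilon> (orbit_of f z))) *
     center_of_mass (eps_nbhd \<epsilon> (orbit_of f z))"

end

theory Submission imports Defs begin

text \<open>
  Near \<open>0\<close> the directed area is the first moment \<open>F z\<close> of the neighbourhood of the orbit, and
  \<open>norm (F z) \<le> C * norm z\<close> because that neighbourhood is the disc of radius \<open>\<epsilon>\<close> up to an annulus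
  of width \<open>O(norm z)\<close>.  On a ray at a small nonzero angle from the attracting direction the orbit
  bends towards that direction, so it lies on one side of the chord from \<open>0\<close> to \<open>z\<close>, and so does
  the moment: \<open>Im (F z / z)\<close> is bounded away from \<open>0\<close>, with opposite signs on the two rays at
  angles \<open>\<phi>\<close> and \<open>- \<phi>\<close>.  If \<open>F\<close> were holomorphic, then by Cauchy's theorem the integrals of
  \<open>F z / z\<^sup>2\<close> along the two rays, from \<open>\<rho>\<close> to a fixed radius, would differ by a quantity bounded
  independently of \<open>\<rho>\<close>; but the imaginary part of the difference grows like \<open>- ln \<rho>\<close>.
\<close>

section \<open>Measure and first moment of neighbourhoods of bounded sets\<close>

lemma lborel_integral_affine:
  fixes f :: "'a::euclidean_space \<Rightarrow> 'b::{banach,second_countable_topology}"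
  assumes "c \<noteq> 0" "f \<in> borel_measurable borel"
  shows "integral\<^sup>L lborel f = \<bar>c\<bar> ^ DIM('a) *\<^sub>R (LINT x|lborel. f (t + c *\<^sub>R x))"
proof -
  have "integral\<^sup>L lborel f = (LINT x|density (distr lborel borel (\<lambda>x::'a. t + c *\<^sub>R x)) (\<lambda>_. ennreal (\<bar>c\<bar> ^ DIM('a))). f x)"
    using lborel_affine[OF assms(1), of t] by simp
  also have "\<dots> = (LINT x|lborel. \<bar>c\<bar> ^ DIM('a) *\<^sub>R f (t + c *\<^sub>R x))"
    using assms by (subst integral_density) (auto simp: integral_distr)
  finally show ?thesis by simp
qed

lemma open_eps_nbhd: "open (eps_nbhd \<epsilon> X)"
  unfolding eps_nbhd_def by blast

lemma eps_nbhd_subset_ball: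
  assumes "X \<subseteq> cball 0 t"
  shows "eps_nbhd \<epsilon> X \<subseteq> ball 0 (\<epsilon> + t)"
proof
  fix w assume "w \<in> eps_nbhd \<epsilon> X"
  then obtain x where "x \<in> X" "dist x w < \<epsilon>" by (auto simp: eps_nbhd_def)
  moreover have "dist 0 w \<le> dist 0 x + dist x w" by (rule dist_triangle)
  ultimately show "w \<in> ball 0 (\<epsilon> + t)" using assms by fastforce
qed

lemma emeasure_bounded_less_top:
  fixes S :: "'a::euclidean_space set"
  assumes "S \<subseteq> ball c r"
  shows "emeasure lborel S < \<infinity>"
  using assms bounded_subset[OF bounded_ball] emeasure_bounded_finite by blast

lemma bounded_fmeasurable:
  fixes S :: "'a::euclidean_space set"
  assumes "S \<subseteq> ball c r" "S \<in> sets borel"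
  shows "S \<in> fmeasurable lborel"
  using assms emeasure_bounded_less_top[OF assms(1)] by (auto simp: fmeasurable_def)

lemma set_integrable_bounded:
  fixes g :: "'a::euclidean_space \<Rightarrow> 'b::{banach,second_countable_topology}"
  assumes "S \<in> sets borel" "S \<subseteq> ball 0 r" "continuous_on UNIV g"
  shows "set_integrable lborel S g"
proof -
  have "set_integrable lborel (cball 0 r) g"
    unfolding set_integrable_def
    by (rule borel_integrable_compact) (auto intro: continuous_on_subset[OF assms(3)])
  then show ?thesis
    by (rule set_integrable_subset) (use assms in auto)
qed

text \<open>The reflection \<open>w \<mapsto> z - w\<close> exchanges the two balls and, because
  \<open>L z = 0\<close>, changes the sign of \<open>L\<close>; hence the integral equals its own
  negative.\<close>

lemma set_integral_ball_union_eq_0: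
  fixes L :: "'a::euclidean_space \<Rightarrow> real"
  assumes L: "bounded_linear L" and z: "L z = 0"
  shows "(LINT w:ball 0 r \<union> ball z r|lborel. L w) = 0"
proof -
  let ?E = "ball 0 r \<union> ball z r"
  interpret L: bounded_linear L by (rule L)
  have [measurable]: "L \<in> borel_measurable borel"
    using L by (rule borel_measurable_continuous_onI[OF linear_continuous_on])
  have "(LINT w:?E|lborel. L w) = (LINT w|lborel. indicator ?E (z + (-1) *\<^sub>R w) *\<^sub>R L (z + (-1) *\<^sub>R w))"
    unfolding set_lebesgue_integral_def
    by (subst lborel_integral_affine[of "-1" _ z])
       (auto intro!: borel_measurable_scaleR borel_measurable_indicator simp del: real_scaleR_def)
  also have "\<dots> = (LINT w|lborel. - (indicator ?E w *\<^sub>R L w))"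
    by (intro Bochner_Integration.integral_cong)
       (auto simp: indicator_def L.diff z dist_norm norm_minus_commute)
  also have "\<dots> = - (LINT w:?E|lborel. L w)"
    unfolding set_lebesgue_integral_def by simp
  finally show ?thesis by simp
qed

lemma set_integral_ball_0_eq_0: "(LINT w:ball 0 r|lborel. w) = (0::'a::euclidean_space)"
proof -
  have "(LINT w:ball 0 r|lborel. w) = (LINT w|lborel. indicator (ball 0 r) (0 + (-1) *\<^sub>R w) *\<^sub>R (0 + (-1) *\<^sub>R (w::'a)))"
    unfolding set_lebesgue_integral_def
    by (subst lborel_integral_affine[of "-1" _ 0])
       (auto intro!: borel_measurable_scaleR borel_measurable_indicator)
  also have "\<dots> = (LINT w|lborel. - (indicator (ball 0 r) w *\<^sub>R w))"
    by (intro Bochner_Integration.integral_cong) (auto simp: indicator_def)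
  also have "\<dots> = - (LINT w:ball 0 r|lborel. w)"
    unfolding set_lebesgue_integral_def by simp
  finally have "(2::real) *\<^sub>R (LINT w:ball 0 r|lborel. (w::'a)) = 0"
    unfolding scaleR_2 by (simp only: eq_neg_iff_add_eq_0)
  then show ?thesis by simp
qed

lemma measure_complex_ball:
  assumes "r \<ge> 0" shows "measure lborel (ball (c::complex) r) = pi * r\<^sup>2"
  using content_ball[of r c] assms by (simp add: unit_ball_vol_2)

lemma measure_complex_cball:
  assumes "r \<ge> 0" shows "measure lborel (cball (c::complex) r) = pi * r\<^sup>2"
  using content_cball[of r c] assms by (simp add: unit_ball_vol_2)

text \<open>The ball of radius \<open>\<epsilon> - t\<close> about 0 lies in the neighbourhood and
  has zero moment by symmetry. What remains lies between the radii \<open>\<epsilon> - t\<close> and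
  \<open>\<epsilon> + t\<close>, a region of area \<open>4 * pi * \<epsilon> * t\<close> in which
  \<open>norm w\<close> is at most \<open>2 * \<epsilon>\<close>; the product of the two is the
  bound.\<close>

lemma norm_set_integral_eps_nbhd_le:
  fixes X :: "complex set"
  assumes "X \<noteq> {}" "X \<subseteq> cball 0 t" "t \<le> \<epsilon>" "\<epsilon> > 0"
  shows "norm (LINT w:eps_nbhd \<epsilon> X|lborel. w) \<le> 8 * pi * \<epsilon>\<^sup>2 * t"
proof -
  define B where "B = ball (0::complex) (\<epsilon> - t)"
  define D where "D = eps_nbhd \<epsilon> X - B"
  obtain x where x: "x \<in> X" using assms by auto
  then have t: "t \<ge> 0" using assms(2) by (meson mem_cball dist_commute order_trans subsetD zero_le_dist)
  have BX: "B \<subseteq> eps_nbhd \<epsilon> X"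
  proof
    fix w assume w: "w \<in> B"
    have "dist x w \<le> dist 0 x + dist 0 w" by (metis dist_commute dist_triangle2)
    with w x assms have "w \<in> ball x \<epsilon>" by (auto simp: B_def)
    then show "w \<in> eps_nbhd \<epsilon> X" using x by (auto simp: eps_nbhd_def)
  qed
  note sub = eps_nbhd_subset_ball[OF assms(2), of \<epsilon>]
  have [measurable]: "B \<in> sets borel" "D \<in> sets borel"
    using open_eps_nbhd[of \<epsilon> X] by (auto simp: B_def D_def)
  have Dsub: "D \<subseteq> ball 0 (\<epsilon> + t)" "B \<subseteq> ball 0 (\<epsilon> + t)" using sub BX by (auto simp: D_def)
  have DB: "D \<inter> B = {}" by (auto simp: D_def)
  have iD: "set_integrable lborel D (\<lambda>w. w)" and iB: "set_integrable lborel B (\<lambda>w. w)"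
    using Dsub by (auto intro!: set_integrable_bounded)
  have "(LINT w:eps_nbhd \<epsilon> X|lborel. w) = (LINT w:B \<union> D|lborel. w)"
    using BX by (intro arg_cong2[where f="\<lambda>S. set_lebesgue_integral lborel S"]) (auto simp: D_def)
  also have "\<dots> = (LINT w:D|lborel. w)"
    using iD iB by (subst set_integral_Un) (auto simp: D_def B_def set_integral_ball_0_eq_0)
  finally have eq: "(LINT w:eps_nbhd \<epsilon> X|lborel. w) = (LINT w:D|lborel. w)" .
  have fD: "emeasure lborel D < \<infinity>" using Dsub(1) by (rule emeasure_bounded_less_top)
  have "norm (LINT w:D|lborel. w) \<le> (LINT w:D|lborel. norm w)"
    using iD by (rule set_integral_norm_bound)
  also have "\<dots> \<le> (LINT w:D|lborel. \<epsilon> + t)"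
    using Dsub fD iD
    by (intro set_integral_mono set_integrable_norm) (auto simp: set_integrable_def)
  also have "\<dots> = (\<epsilon> + t) * measure lborel D"
    using fD by (subst set_integral_const) auto
  finally have le: "norm (LINT w:D|lborel. w) \<le> (\<epsilon> + t) * measure lborel D" .
  have "measure lborel D \<le> measure lborel (ball (0::complex) (\<epsilon> + t) - B)"
    using \<open>D \<subseteq> ball 0 (\<epsilon> + t)\<close>
    by (intro measure_mono_fmeasurable bounded_fmeasurable[where c=0 and r="\<epsilon> + t"])
       (use DB in \<open>auto simp: B_def\<close>)
  also have "\<dots> = pi * (\<epsilon> + t)\<^sup>2 - pi * (\<epsilon> - t)\<^sup>2"
    using t assms emeasure_lborel_ball_finite[of "0::complex" "\<epsilon> + t"]
    by (subst measure_Diff) (auto simp: B_def measure_complex_ball)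
  also have "\<dots> = 4 * pi * \<epsilon> * t" by (simp add: power2_eq_square algebra_simps)
  finally have "(\<epsilon> + t) * measure lborel D \<le> (2 * \<epsilon>) * (4 * pi * \<epsilon> * t)"
    using assms t by (intro mult_mono) auto
  then show ?thesis using eq le by (simp add: power2_eq_square algebra_simps)
qed


section \<open>Lower bound for the moment of a neighbourhood of a one-sided set\<close>

text \<open>If \<open>P\<close> and \<open>L\<close> are orthonormal coordinates and
  \<open>0 < \<gamma> < 1\<close>, this is the circular sector of radius \<open>\<rho>\<close> about
  the positive \<open>L\<close>-axis whose half-angle has sine \<open>\<gamma>\<close>. It is given
  through linear forms so that scaling and openness are immediate.\<close>

definition truncated_cone :: "(complex \<Rightarrow> real) \<Rightarrow> (complex \<Rightarrow> real) \<Rightarrow> real \<Rightarrow> real \<Rightarrow> complex set" where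
  "truncated_cone P L \<gamma> \<rho> = {w. norm w < \<rho> \<and> \<bar>P w\<bar> < \<gamma> * norm w \<and> 0 < L w}"

lemma open_truncated_cone:
  assumes "bounded_linear P" "bounded_linear L"
  shows "open (truncated_cone P L \<gamma> \<rho>)"
proof -
  have [continuous_intros]: "continuous_on UNIV P" "continuous_on UNIV L"
    using assms by (auto intro: linear_continuous_on)
  show ?thesis unfolding truncated_cone_def
    by (intro open_Collect_conj open_Collect_less continuous_intros)
qed

text \<open>The angular conditions are homogeneous, so the set is the \<open>\<rho>\<close>-fold
  dilation of the one of radius 1, and the Jacobian in the plane is
  \<open>\<rho>\<^sup>2\<close>.\<close>

lemma measure_truncated_cone:
  assumes P: "bounded_linear P" and L: "bounded_linear L" and "\<rho> > 0"
  shows "measure lborel (truncated_cone P L \<gamma> \<rho>) = \<rho>\<^sup>2 * measure lborel (truncated_cone P L \<gamma> 1)"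
proof -
  interpret P: bounded_linear P by (rule P)
  interpret L: bounded_linear L by (rule L)
  have [measurable]: "truncated_cone P L \<gamma> r \<in> sets borel" for r
    using open_truncated_cone[OF P L] by simp
  have "measure lborel (truncated_cone P L \<gamma> \<rho>) = (LINT w|lborel. indicator (truncated_cone P L \<gamma> \<rho>) w)"
    by simp
  also have "\<dots> = \<rho>\<^sup>2 * (LINT w|lborel. indicator (truncated_cone P L \<gamma> \<rho>) (0 + \<rho> *\<^sub>R w))"
    using assms by (subst lborel_integral_affine[of \<rho> _ 0]) auto
  also have "(LINT w|lborel. indicat_real (truncated_cone P L \<gamma> \<rho>) (0 + \<rho> *\<^sub>R w))
      = (LINT w|lborel. indicator (truncated_cone P L \<gamma> 1) w)"
    using \<open>\<rho> > 0\<close>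
    by (intro Bochner_Integration.integral_cong)
       (auto simp: indicator_def truncated_cone_def P.scaleR L.scaleR abs_mult zero_less_mult_iff)
  finally show ?thesis by simp
qed

text \<open>Here \<open>P\<close> and \<open>L\<close> are orthonormal coordinates in which the chord from \<open>0\<close> to \<open>z\<close> lies on
  the axis \<open>L = 0\<close>, and \<open>X\<close> lies above it.  The balls around \<open>0\<close> and \<open>z\<close> contribute nothing to the
  moment of \<open>L\<close>.  What the neighbourhood contains besides lies in a thin annulus of area
  \<open>O(t\<^sup>2)\<close> if it is below the axis, while the point \<open>y\<close> contributes above the axis a part of a
  cone of area of order \<open>t\<close>.\<close>

lemma moment_eps_nbhd_ge:
  fixes P L :: "complex \<Rightarrow> real"
  assumes P: "bounded_linear P" and L: "bounded_linear L"
    and norm_PL: "\<And>w. (norm w)\<^sup>2 = (P w)\<^sup>2 + (L w)\<^sup>2"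
    and u: "P u = 0" "L u = 1"
    and "\<epsilon> > 0" and \<delta>: "0 < \<delta>" "\<delta> \<le> 1"
  obtains c t0 where "c > 0" "t0 > 0"
    "\<And>X z y t. 0 < t \<Longrightarrow> t < t0 \<Longrightarrow> z \<in> X \<Longrightarrow> 0 \<in> closure X \<Longrightarrow> P z = t \<Longrightarrow> L z = 0 \<Longrightarrow>
       (\<And>x. x \<in> X \<Longrightarrow> 0 \<le> P x \<and> P x \<le> t \<and> 0 \<le> L x \<and> norm x \<le> t) \<Longrightarrow>
       y \<in> X \<Longrightarrow> \<delta> * t \<le> L y \<Longrightarrow> c * t \<le> L (LINT w:eps_nbhd \<epsilon> X|lborel. w)"
proof -
  interpret P: bounded_linear P by (rule P)
  interpret L: bounded_linear L by (rule L)
  \<comment> \<open>Narrow enough that in the expansion of the squared distance from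
    \<open>w\<close> to \<open>y\<close> the term \<open>P w * P y\<close> costs at most
    \<open>\<delta> * s * t / 8\<close>, against the gain \<open>\<delta> * s * t / 2\<close> from
    \<open>L w * L y\<close>, where \<open>s = norm w\<close>.\<close>
  define \<gamma> where "\<gamma> = \<delta> / 8"
  have \<gamma>: "0 < \<gamma>" "\<gamma> \<le> 1/8" using \<delta> by (auto simp: \<gamma>_def)
  let ?C = "truncated_cone P L \<gamma>"
  define \<kappa> where "\<kappa> = measure lborel (?C 1)"
  have C[measurable]: "?C r \<in> sets borel" for r
    using open_truncated_cone[OF P L] by simp
  have C_ball: "?C r \<subseteq> ball 0 r" for r by (auto simp: truncated_cone_def)
  have C_top: "emeasure lborel (?C r) \<noteq> \<infinity>" for r
    using emeasure_bounded_less_top[OF C_ball, of r] by simp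
  \<comment> \<open>A ball around half of \<open>u\<close> fits into the open cone, which makes the
    area \<open>\<kappa>\<close> positive.\<close>
  have "norm u = 1" using norm_PL[of u] u by (metis add.left_neutral norm_ge_zero one_power2 power2_eq_imp_eq zero_eq_power2 zero_le_one)
  then have "(1/2) *\<^sub>R u \<in> ?C 1"
    using u \<gamma> by (auto simp: truncated_cone_def P.scaleR L.scaleR)
  then obtain d x where "d > 0" and d: "ball x d \<subseteq> ?C 1"
    using open_truncated_cone[OF P L] openE by blast
  then have "0 < measure lborel (ball x d)" by (simp add: measure_complex_ball)
  also have "\<dots> \<le> \<kappa>"
    unfolding \<kappa>_def using d C_ball
    by (intro measure_mono_fmeasurable bounded_fmeasurable[where c=0 and r=1]) auto
  finally have \<kappa>: "\<kappa> > 0" .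
  \<comment> \<open>The gain is \<open>\<epsilon> / 2\<close>, a lower bound for \<open>L\<close> on
    \<open>R\<close>, times the area of \<open>R\<close>, at least
    \<open>\<epsilon> * \<delta> / 8 * t * \<kappa>\<close>; this is \<open>2 * c * t\<close>. The
    second entry of \<open>t0\<close> keeps the loss \<open>2 * pi * \<epsilon> * t\<^sup>2\<close>
    below \<open>c * t\<close>, the first makes \<open>t\<^sup>2\<close> small against the
    shortening of the distance to \<open>y\<close>.\<close>
  define c where "c = \<epsilon>\<^sup>2 * \<delta> * \<kappa> / 32"
  define t0 where "t0 = min (\<epsilon> * \<delta> / 16) (c / (2 * pi * \<epsilon>))"
  have c: "c > 0" using \<kappa> \<delta> \<open>\<epsilon> > 0\<close> by (simp add: c_def)
  have t0: "t0 > 0" using c \<delta> \<open>\<epsilon> > 0\<close> by (simp add: t0_def)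
  have dist_PL: "(dist w x)\<^sup>2 = (P w - P x)\<^sup>2 + (L w - L x)\<^sup>2" for w x
    by (simp add: dist_norm norm_PL P.diff L.diff)
  have "c * t \<le> L (LINT w:eps_nbhd \<epsilon> X|lborel. w)"
    if t: "0 < t" "t < t0" and z: "z \<in> X" "P z = t" "L z = 0" and X0: "0 \<in> closure X"
      and X: "\<And>x. x \<in> X \<Longrightarrow> 0 \<le> P x \<and> P x \<le> t \<and> 0 \<le> L x \<and> norm x \<le> t"
      and y: "y \<in> X" "\<delta> * t \<le> L y" for X z y t
  proof -
    let ?N = "eps_nbhd \<epsilon> X"
    define E where "E = ball 0 \<epsilon> \<union> ball z \<epsilon>"
    define D where "D = ?N - E"
    \<comment> \<open>To first order in \<open>t\<close>, a point of the cone of norm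
      \<open>s\<close> has distance at most \<open>s - 3/8 * \<delta> * t\<close> from
      \<open>y\<close> and at least \<open>s - 1/8 * \<delta> * t\<close> from \<open>z\<close>.
      Both radii exceed \<open>\<epsilon>\<close> by a multiple of \<open>\<delta> * t\<close>
      between these two fractions, so the part \<open>R\<close> of the cone between them lies in
      \<open>ball y \<epsilon>\<close> but outside \<open>E\<close>.\<close>
    define \<rho>1 where "\<rho>1 = \<epsilon> + \<delta> / 4 * t"
    define \<rho>2 where "\<rho>2 = \<epsilon> + 5 * \<delta> / 16 * t"
    define R where "R = ?C \<rho>2 - ?C \<rho>1"
    define r where "r = sqrt (\<epsilon>\<^sup>2 + t\<^sup>2)"
    define T where "T = cball 0 r - ball (0::complex) \<epsilon>"
    have t\<epsilon>: "t < \<epsilon> * \<delta> / 16" "t < c / (2 * pi * \<epsilon>)" using t by (auto simp: t0_def)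
    have "\<epsilon> * \<delta> \<le> \<epsilon> * 1" using \<delta> \<open>\<epsilon> > 0\<close> by (intro mult_left_mono) auto
    with t\<epsilon> have t_le: "t < \<epsilon>" using \<open>\<epsilon> > 0\<close> by linarith
    have \<rho>: "0 < \<rho>1" "\<rho>1 < \<rho>2" using t \<delta> \<open>\<epsilon> > 0\<close> by (auto simp: \<rho>1_def \<rho>2_def add_pos_pos)
    have Xt: "X \<subseteq> cball 0 t" using X by auto
    note sub = eps_nbhd_subset_ball[OF Xt, of \<epsilon>]
    \<comment> \<open>The point 0 is only a limit of points of \<open>X\<close>; since the balls are
      open, \<open>ball 0 \<epsilon>\<close> is still covered by balls around points of
      \<open>X\<close> close to 0.\<close>
    have EN: "E \<subseteq> ?N"
    proof -
      have "w \<in> ?N" if w: "norm w < \<epsilon>" for w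
      proof -
        obtain x where "x \<in> X" "dist x 0 < \<epsilon> - norm w"
          using X0 w unfolding closure_approachable by (metis diff_gt_0_iff_gt)
        moreover from this have "dist x w < \<epsilon>"
          using dist_triangle[of x w 0] by (simp add: dist_norm)
        ultimately show ?thesis by (auto simp: eps_nbhd_def)
      qed
      then show ?thesis using z by (auto simp: E_def eps_nbhd_def)
    qed
    have [measurable]: "E \<in> sets borel" "D \<in> sets borel" "R \<in> sets borel" "T \<in> sets borel" "?N \<in> sets borel"
      using open_eps_nbhd[of \<epsilon> X] by (auto simp: E_def D_def R_def T_def)
    have bounds: "E \<subseteq> ball 0 (\<epsilon> + t)" "D \<subseteq> ball 0 (\<epsilon> + t)" using sub EN by (auto simp: D_def)
    have contL: "continuous_on UNIV L" using L by (rule linear_continuous_on)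
    have iN: "set_integrable lborel ?N (\<lambda>w. w)"
      using sub by (intro set_integrable_bounded) auto
    have iE: "set_integrable lborel E L" and iD: "set_integrable lborel D L"
      using bounds contL by (auto intro!: set_integrable_bounded)
    have "L (LINT w:?N|lborel. w) = (LINT w:?N|lborel. L w)"
      using integral_bounded_linear[OF L iN[unfolded set_integrable_def]]
      by (simp add: set_lebesgue_integral_def L.scaleR)
    also have "\<dots> = (LINT w:E \<union> D|lborel. L w)"
      using EN by (intro arg_cong2[where f="\<lambda>S. set_lebesgue_integral lborel S"]) (auto simp: D_def)
    also have "\<dots> = (LINT w:D|lborel. L w)"
      using iE iD set_integral_ball_union_eq_0[OF L z(3), of \<epsilon>]
      by (subst set_integral_Un) (auto simp: D_def E_def)
    finally have eq: "L (LINT w:?N|lborel. w) = (LINT w:D|lborel. L w)" .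

    \<comment> \<open>Moving the centre \<open>x\<close> vertically to the axis only brings it
      closer to a point \<open>w\<close> below. If \<open>P w\<close> were negative or larger than
      \<open>t\<close>, the end 0 or \<open>z\<close> of the chord would be closer still, and
      \<open>w\<close> would lie in \<open>E\<close>. So \<open>w\<close> is under the chord, where
      it exceeds the circle of radius \<open>\<epsilon>\<close> so little that it falls into the
      annulus \<open>T\<close> of area \<open>pi * t\<^sup>2\<close>.\<close>
    have below: "w \<in> T" if w: "w \<in> D" "L w < 0" for w
    proof -
      from w obtain x where x: "x \<in> X" "dist w x < \<epsilon>"
        by (auto simp: D_def eps_nbhd_def dist_commute)
      have wE: "\<epsilon> \<le> norm w" "\<epsilon> \<le> dist w z"
        using w by (auto simp: D_def E_def dist_commute not_less)
      have "(dist w x)\<^sup>2 < \<epsilon>\<^sup>2" using x \<open>\<epsilon> > 0\<close> by (intro power_strict_mono) auto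
      then have *: "(P w - P x)\<^sup>2 + (L w - L x)\<^sup>2 < \<epsilon>\<^sup>2" by (simp add: dist_PL)
      have Px: "0 \<le> P x" "P x \<le> t" "0 \<le> L x" using X[OF x(1)] by auto
      have "(L w)\<^sup>2 \<le> (L w - L x)\<^sup>2" using w(2) Px(3) by (intro abs_le_square_iff[THEN iffD1]) auto
      with * have **: "(P w - P x)\<^sup>2 + (L w)\<^sup>2 < \<epsilon>\<^sup>2" by linarith
      have n1: "\<epsilon>\<^sup>2 \<le> (P w)\<^sup>2 + (L w)\<^sup>2"
        using wE(1) \<open>\<epsilon> > 0\<close> norm_PL[of w] power_mono[of \<epsilon> "norm w" 2] by simp
      have n2: "\<epsilon>\<^sup>2 \<le> (P w - t)\<^sup>2 + (L w)\<^sup>2"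
        using wE(2) \<open>\<epsilon> > 0\<close> dist_PL[of w z] z power_mono[of \<epsilon> "dist w z" 2] by simp
      have "0 \<le> P w"
      proof (rule ccontr)
        assume "\<not> 0 \<le> P w"
        then have "(P w)\<^sup>2 \<le> (P w - P x)\<^sup>2" using Px by (intro abs_le_square_iff[THEN iffD1]) auto
        then show False using ** n1 by linarith
      qed
      moreover have "P w \<le> t"
      proof (rule ccontr)
        assume "\<not> P w \<le> t"
        then have "(P w - t)\<^sup>2 \<le> (P w - P x)\<^sup>2" using Px by (intro abs_le_square_iff[THEN iffD1]) auto
        then show False using ** n2 by linarith
      qed
      ultimately have "(P w)\<^sup>2 \<le> t\<^sup>2" by (intro power_mono)
      moreover have "(L w)\<^sup>2 < \<epsilon>\<^sup>2" using ** zero_le_power2[of "P w - P x"] by linarith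
      ultimately have "(norm w)\<^sup>2 \<le> \<epsilon>\<^sup>2 + t\<^sup>2" using norm_PL[of w] by linarith
      then have "norm w \<le> r" unfolding r_def by (rule real_le_rsqrt)
      then show ?thesis using wE by (simp add: T_def)
    qed

    have above: "w \<in> D \<and> \<epsilon> / 2 \<le> L w" if "w \<in> R" for w
    proof -
      have w: "\<rho>1 \<le> norm w" "norm w < \<rho>2" "\<bar>P w\<bar> < \<gamma> * norm w" "0 < L w"
        using that by (auto simp: R_def truncated_cone_def)
      define s where "s = norm w"
      have s: "\<epsilon> < s" "s \<ge> \<rho>1" "s < \<rho>2" using w t \<delta> by (auto simp: \<rho>1_def s_def intro: less_le_trans[rotated])
      have "s * \<gamma> \<le> s * (1/8)" using \<gamma> s \<open>\<epsilon> > 0\<close> by (intro mult_left_mono) auto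
      then have Ps: "\<bar>P w\<bar> \<le> s / 8" using w s_def by (simp add: mult.commute)
      have "(L w)\<^sup>2 \<ge> s\<^sup>2 - (s/8)\<^sup>2"
        using power_mono[OF Ps, of 2] norm_PL[of w] by (simp add: s_def)
      also have "s\<^sup>2 - (s/8)\<^sup>2 = 63/64 * s\<^sup>2" by (simp add: power2_eq_square)
      finally have "63/64 * s\<^sup>2 \<le> (L w)\<^sup>2" .
      moreover have "(s / 2)\<^sup>2 = s\<^sup>2 / 4" by (simp add: power_divide)
      ultimately have "(s / 2)\<^sup>2 \<le> (L w)\<^sup>2" using zero_le_power2[of s] by linarith
      then have Lw: "s / 2 \<le> L w" using w(4) by (rule power2_le_imp_le[OF _ less_imp_le])
      have Py: "0 \<le> P y" "P y \<le> t" "norm y \<le> t" using X[OF y(1)] by auto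
      have ndist: "(dist w x)\<^sup>2 = s\<^sup>2 - 2 * (P w * P x) - 2 * (L w * L x) + (norm x)\<^sup>2" for x
        unfolding dist_PL s_def norm_PL by (simp add: power2_eq_square algebra_simps)
      define q where "q = \<delta> * s * t"
      have a1: "P w * P y \<ge> - (\<delta> * s * t / 8)"
      proof -
        have "\<bar>P w * P y\<bar> \<le> (\<gamma> * s) * t"
          unfolding abs_mult using w Py t by (intro mult_mono) (auto simp: s_def)
        then show ?thesis by (simp add: \<gamma>_def abs_le_iff)
      qed
      have "L w * L y \<ge> (s / 2) * (\<delta> * t)"
        using Lw y \<delta> t s \<open>\<epsilon> > 0\<close> by (intro mult_mono) auto
      then have a2: "L w * L y \<ge> \<delta> * s * t / 2" by (simp add: mult_ac)
      have a3: "(norm y)\<^sup>2 \<le> t\<^sup>2" using Py by (intro power_mono) auto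
      have "(dist w y)\<^sup>2 \<le> s\<^sup>2 - 3/4 * (\<delta> * s * t) + t\<^sup>2"
        unfolding ndist using a1 a2 a3 unfolding q_def[symmetric] by linarith
      also have "\<dots> = s * (s - 3/4 * \<delta> * t) + t\<^sup>2" by (simp add: power2_eq_square algebra_simps)
      also have "\<dots> \<le> s * (\<epsilon> - 7/16 * \<delta> * t) + t\<^sup>2"
        using s \<open>\<epsilon> > 0\<close> by (intro add_right_mono mult_left_mono) (auto simp: \<rho>2_def)
      also have "\<dots> \<le> \<rho>2 * (\<epsilon> - 7/16 * \<delta> * t) + t\<^sup>2"
      proof (intro add_right_mono mult_right_mono)
        have "\<delta> * t \<le> 1 * t" using \<delta> t by (intro mult_right_mono) auto
        then show "0 \<le> \<epsilon> - 7/16 * \<delta> * t" using t_le t by linarith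
      qed (use s in auto)
      also have "\<dots> = \<epsilon>\<^sup>2 - (\<epsilon> * \<delta> / 8) * t - (35/256) * (\<delta> * t)\<^sup>2 + t\<^sup>2"
        by (simp add: \<rho>2_def power2_eq_square algebra_simps)
      \<comment> \<open>By the first entry of \<open>t0\<close>, \<open>t\<^sup>2\<close> is less
        than half of the linear gain \<open>\<epsilon> * \<delta> / 8 * t\<close>.\<close>
      also have "\<dots> < \<epsilon>\<^sup>2"
      proof -
        have "t * t < (\<epsilon> * \<delta> / 16) * t" using t\<epsilon> t by (intro mult_strict_right_mono) auto
        moreover have "0 \<le> (\<delta> * t)\<^sup>2" "0 < \<epsilon> * \<delta> / 8 * t" using t \<delta> \<open>\<epsilon> > 0\<close> by auto
        moreover have "t\<^sup>2 = t * t" by (rule power2_eq_square)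
        ultimately show ?thesis by linarith
      qed
      finally have "dist w y < \<epsilon>" using \<open>\<epsilon> > 0\<close> by (rule power2_less_imp_less[OF _ less_imp_le])
      then have wN: "w \<in> ?N" using y by (auto simp: eps_nbhd_def dist_commute)
      have "P w * t \<le> \<gamma> * s * t" using w t by (intro mult_right_mono) (auto simp: s_def)
      then have "P w * P z \<le> q / 8" by (simp add: z q_def \<gamma>_def)
      then have "s\<^sup>2 - q / 4 \<le> (dist w z)\<^sup>2"
        using ndist[of z] zero_le_power2[of "norm z"] unfolding z(3) mult_zero_right by linarith
      moreover have "s\<^sup>2 - q / 4 = s * (s - \<delta> / 4 * t)"
        by (simp add: q_def power2_eq_square algebra_simps)
      ultimately have "s * (s - \<delta> / 4 * t) \<le> (dist w z)\<^sup>2" by simp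
      moreover have "s * (s - \<delta> / 4 * t) \<ge> \<epsilon> * \<epsilon>"
        using s \<open>\<epsilon> > 0\<close> by (intro mult_mono) (auto simp: \<rho>1_def)
      ultimately have "\<epsilon>\<^sup>2 \<le> (dist w z)\<^sup>2" by (simp add: power2_eq_square)
      then have "\<epsilon> \<le> dist w z" by (rule power2_le_imp_le) simp
      then show ?thesis using wN s Lw by (auto simp: D_def E_def dist_commute s_def)
    qed

    have fR: "emeasure lborel R < \<infinity>" and fT: "emeasure lborel T < \<infinity>"
    proof -
      have "R \<subseteq> ball 0 \<rho>2" "T \<subseteq> ball 0 (r + 1)" using C_ball by (auto simp: R_def T_def)
      then show "emeasure lborel R < \<infinity>" "emeasure lborel T < \<infinity>"
        using emeasure_bounded_less_top by blast+
    qed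
    \<comment> \<open>On \<open>R\<close>, which lies in \<open>D\<close>, the integrand is at least
      \<open>\<epsilon> / 2\<close>. It is negative only at points of \<open>T\<close>, and there it
      is at least \<open>- 2 * \<epsilon>\<close>.\<close>
    have pointwise: "\<epsilon> / 2 * indicator R w - 2 * \<epsilon> * indicator T w \<le> indicator D w *\<^sub>R L w" for w
    proof (cases "w \<in> D")
      case True
      have "norm w < \<epsilon> + t" using True bounds by auto
      then have nw: "norm w \<le> 2 * \<epsilon>" using t_le by simp
      have "\<bar>L w\<bar> \<le> norm w" using norm_PL[of w] by (intro abs_le_square_iff[THEN iffD2, of "L w" "norm w", simplified]) auto
      with True below[of w] above[of w] nw \<open>\<epsilon> > 0\<close> show ?thesis
        by (cases "w \<in> R"; cases "w \<in> T"; cases "L w < 0") auto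
    next
      case False
      then show ?thesis using above[of w] \<open>\<epsilon> > 0\<close> by (auto simp: indicator_def)
    qed
    have intRT: "integrable lborel (\<lambda>w. \<epsilon> / 2 * indicator R w - 2 * \<epsilon> * indicator T w)"
      using fR fT by (intro Bochner_Integration.integrable_diff integrable_mult_right integrable_real_indicator) auto
    have "\<epsilon> / 2 * measure lborel R - 2 * \<epsilon> * measure lborel T
        = (LINT w|lborel. \<epsilon> / 2 * indicator R w - 2 * \<epsilon> * indicator T w)"
      using fR fT by (subst Bochner_Integration.integral_diff)
        (auto intro!: integrable_mult_right integrable_real_indicator)
    also have "\<dots> \<le> (LINT w:D|lborel. L w)"
      unfolding set_lebesgue_integral_def
      using intRT iD[unfolded set_integrable_def] pointwise by (intro integral_mono) auto
    finally have main: "\<epsilon> / 2 * measure lborel R - 2 * \<epsilon> * measure lborel T \<le> L (LINT w:?N|lborel. w)"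
      by (simp add: eq)
    have "measure lborel R = (\<rho>2\<^sup>2 - \<rho>1\<^sup>2) * \<kappa>"
    proof -
      have "?C \<rho>1 \<subseteq> ?C \<rho>2" using \<rho> by (auto simp: truncated_cone_def)
      then have "measure lborel R = measure lborel (?C \<rho>2) - measure lborel (?C \<rho>1)"
        unfolding R_def using C_top[of \<rho>2] by (subst measure_Diff) auto
      also have "\<dots> = \<rho>2\<^sup>2 * \<kappa> - \<rho>1\<^sup>2 * \<kappa>"
        unfolding \<kappa>_def using \<rho> by (subst (1 2) measure_truncated_cone[OF P L]) auto
      finally show ?thesis by (simp add: algebra_simps)
    qed
    moreover have "\<rho>2\<^sup>2 - \<rho>1\<^sup>2 \<ge> \<epsilon> * \<delta> / 8 * t"
      using zero_le_power2[of "\<delta> * t"] by (simp add: \<rho>2_def \<rho>1_def power2_eq_square algebra_simps)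
    ultimately have mR: "measure lborel R \<ge> \<epsilon> * \<delta> / 8 * t * \<kappa>"
      using \<kappa> by (simp add: mult_right_mono)
    have "\<epsilon> \<le> r" unfolding r_def by (rule real_le_rsqrt) simp
    then have "measure lborel T = pi * r\<^sup>2 - pi * \<epsilon>\<^sup>2"
      unfolding T_def using \<open>\<epsilon> > 0\<close> emeasure_lborel_cball_finite[of "0::complex" r]
      by (subst measure_Diff) (auto simp: measure_complex_ball measure_complex_cball)
    then have mT: "measure lborel T = pi * t\<^sup>2" by (simp add: r_def algebra_simps)
    have "2 * c * t - 2 * pi * \<epsilon> * t * t \<le> \<epsilon> / 2 * measure lborel R - 2 * \<epsilon> * measure lborel T"
      using mult_left_mono[OF mR, of "\<epsilon> / 2"] \<open>\<epsilon> > 0\<close> unfolding mT c_def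
      by (simp add: power2_eq_square algebra_simps)
    moreover have "2 * pi * \<epsilon> * t * t \<le> c * t"
      using t\<epsilon>(2) t \<open>\<epsilon> > 0\<close> by (intro mult_right_mono) (auto simp: field_simps)
    ultimately show ?thesis using main by linarith
  qed
  then show ?thesis using that[OF c t0] by blast
qed

section \<open>Orbits of a parabolic germ near the fixed point\<close>

text \<open>In the coordinate \<open>W = inverse (z ^ k) / (- k a)\<close> the map is close to translation by \<open>1\<close>.\<close>

lemma parabolic_leading_term_expansion:
  assumes "parabolic_leading_term f k a"
  shows "((\<lambda>z. f z / z) \<longlongrightarrow> 1) (at 0)"
    and "((\<lambda>z. inverse (f z ^ k) - inverse (z ^ k)) \<longlongrightarrow> - (of_nat k * a)) (at 0)"
proof -
  have k: "k \<ge> 1" and lim: "((\<lambda>z. (f z - (z + a * z ^ (k + 1))) / z ^ (k + 1)) \<longlongrightarrow> 0) (at 0)"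
    using assms smalloD_tendsto by (auto simp: parabolic_leading_term_def)
  have nz: "eventually (\<lambda>z. z \<noteq> (0::complex)) (at 0)"
    by (simp add: eventually_at_filter)
  have "((\<lambda>z. (f z - (z + a * z ^ (k + 1))) / z ^ (k + 1) + a) \<longlongrightarrow> 0 + a) (at 0)"
    by (intro tendsto_intros lim)
  then have q: "((\<lambda>z. (f z / z - 1) / z ^ k) \<longlongrightarrow> a) (at 0)"
    unfolding add_0_left
    by (rule Lim_transform_eventually) (use nz in \<open>auto elim!: eventually_mono simp: field_simps\<close>)
  have "((\<lambda>z. (f z / z - 1) / z ^ k * z ^ k + 1) \<longlongrightarrow> a * 0 ^ k + 1) (at 0)"
    by (intro tendsto_intros q)
  then have "((\<lambda>z. (f z / z - 1) / z ^ k * z ^ k + 1) \<longlongrightarrow> 1) (at 0)"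
    using k by (simp add: power_0_left)
  then show y: "((\<lambda>z. f z / z) \<longlongrightarrow> 1) (at 0)"
    by (rule Lim_transform_eventually) (use nz k in \<open>auto elim!: eventually_mono\<close>)
  \<comment> \<open>Caratheodory's form of the derivative at 1 writes
    \<open>y \<mapsto> inverse (y ^ k)\<close> with a slope function \<open>h\<close> continuous at
    1, so \<open>y = f z / z\<close> can be substituted without dividing by
    \<open>y - 1\<close>.\<close>
  have "((\<lambda>y. inverse (y ^ k)) has_field_derivative - of_nat k) (at (1::complex))"
    by (auto intro!: derivative_eq_intros)
  then obtain h where h: "\<And>y::complex. inverse (y ^ k) - inverse (1 ^ k) = h y * (y - 1)" "isCont h 1" "h 1 = - of_nat k"
    unfolding CARAT_DERIV by blast
  have "((\<lambda>z. h (f z / z)) \<longlongrightarrow> - of_nat k) (at 0)"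
    using isCont_tendsto_compose[OF h(2) y] h(3) by simp
  then have "((\<lambda>z. h (f z / z) * ((f z / z - 1) / z ^ k)) \<longlongrightarrow> - of_nat k * a) (at 0)"
    by (intro tendsto_intros q)
  then have "((\<lambda>z. h (f z / z) * ((f z / z - 1) / z ^ k)) \<longlongrightarrow> - (of_nat k * a)) (at 0)" by simp
  then show "((\<lambda>z. inverse (f z ^ k) - inverse (z ^ k)) \<longlongrightarrow> - (of_nat k * a)) (at 0)"
  proof (rule Lim_transform_eventually)
    show "\<forall>\<^sub>F z in at 0. h (f z / z) * ((f z / z - 1) / z ^ k) = inverse (f z ^ k) - inverse (z ^ k)"
      using nz
    proof eventually_elim
      case (elim z)
      have "h (f z / z) * ((f z / z - 1) / z ^ k) = (inverse ((f z / z) ^ k) - 1) / z ^ k"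
        using h(1)[of "f z / z"] by simp
      also have "\<dots> = inverse (f z ^ k) - inverse (z ^ k)"
        using elim by (simp add: power_divide diff_divide_distrib inverse_eq_divide)
      finally show ?case .
    qed
  qed
qed

lemma inverse_power_eq_exp:
  assumes "\<tau> \<noteq> (0::complex)"
  shows "exp (- (of_nat k * Ln \<tau>)) = inverse (\<tau> ^ k)"
  using assms by (simp add: exp_minus exp_of_nat_mult)

text \<open>Each step moves \<open>W\<close> by a vector within \<open>1/4\<close> of 1, so after
  \<open>n\<close> steps the displacement \<open>d\<close> is within \<open>n / 4\<close> of
  \<open>n\<close>. Both \<open>d\<close> and the initial \<open>W\<close> lie in the sector where
  the imaginary part is at most the real part in modulus, hence \<open>W\<close> never gets smaller
  in modulus and the orbit never leaves the disc of radius \<open>norm z\<close>. Taking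
  \<open>k\<close>-th roots along a continuous branch recovers the orbit from
  \<open>d\<close>.\<close>

lemma parabolic_orbit:
  assumes "parabolic_leading_term f k a"
  obtains r where "r > 0"
    "\<And>z n. z \<noteq> 0 \<Longrightarrow> norm z < r \<Longrightarrow> \<bar>Im (inverse (z ^ k) / (- (of_nat k * a)))\<bar> \<le> Re (inverse (z ^ k) / (- (of_nat k * a)))
      \<Longrightarrow> \<exists>d. norm (d - of_nat n) \<le> real n / 4 \<and> norm ((f ^^ n) z) \<le> norm z \<and>
           0 \<le> Re (d / (inverse (z ^ k) / (- (of_nat k * a)))) \<and>
           (f ^^ n) z = z * exp (- (Ln (1 + d / (inverse (z ^ k) / (- (of_nat k * a)))) / of_nat k))"
proof -
  note lim = parabolic_leading_term_expansion[OF assms]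
  have k: "k \<ge> 1" and a: "a \<noteq> 0" using assms by (auto simp: parabolic_leading_term_def)
  define b where "b = - (of_nat k * a)"
  have b: "b \<noteq> 0" using k a by (simp add: b_def)
  define W where "W = (\<lambda>z. inverse (z ^ k) / b)"
  have "((\<lambda>z. (inverse (f z ^ k) - inverse (z ^ k)) / b) \<longlongrightarrow> b / b) (at 0)"
    using lim(2) b by (intro tendsto_intros) (auto simp: b_def)
  then have limW: "((\<lambda>z. W (f z) - W z) \<longlongrightarrow> 1) (at 0)"
    using b by (simp add: W_def diff_divide_distrib)
  have limLn: "((\<lambda>z. \<bar>Im (Ln (f z / z))\<bar>) \<longlongrightarrow> \<bar>Im (Ln 1)\<bar>) (at 0)"
    by (intro tendsto_intros lim(1)) auto
  \<comment> \<open>The first condition keeps orbits away from 0, the second controls the drift of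
    \<open>W\<close>, and the third makes the argument of one step, multiplied by \<open>k\<close>,
    smaller than \<open>pi / 2\<close>.\<close>
  have "\<forall>\<^sub>F z in at 0. f z / z \<noteq> 0 \<and> dist (W (f z) - W z) 1 < 1/4 \<and> \<bar>Im (Ln (f z / z))\<bar> < pi / (2 * real k)"
    using tendsto_imp_eventually_ne[OF lim(1), of 0] tendstoD[OF limW, of "1/4"]
      order_tendstoD(2)[OF limLn, of "pi / (2 * real k)"] k
    by (intro eventually_conj) auto
  then obtain r where r: "r > 0" and step: "\<And>z. z \<noteq> 0 \<Longrightarrow> norm z < r \<Longrightarrow>
      f z \<noteq> 0 \<and> norm (W (f z) - W z - 1) < 1/4 \<and> \<bar>Im (Ln (f z / z))\<bar> < pi / (2 * real k)"
    unfolding eventually_at by (fastforce simp: dist_norm)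
  show ?thesis
  proof (rule that[OF r])
    fix z :: complex and n :: nat
    assume z: "z \<noteq> 0" "norm z < r"
      and "\<bar>Im (inverse (z ^ k) / (- (of_nat k * a)))\<bar> \<le> Re (inverse (z ^ k) / (- (of_nat k * a)))"
    then have W0: "\<bar>Im (W z)\<bar> \<le> Re (W z)" by (simp add: W_def b_def)
    have Wnz: "W x \<noteq> 0" if "x \<noteq> 0" for x using that b by (simp add: W_def)
    \<comment> \<open>Two vectors of the sector of half-angle \<open>pi / 4\<close> about the
      positive real axis form an angle of at most \<open>pi / 2\<close>.\<close>
    have Re_quot: "0 \<le> Re (d / W z)" if d: "norm (d - of_nat n) \<le> real n / 4" for d n
    proof -
      have "\<bar>Re d - n\<bar> \<le> n / 4" "\<bar>Im d\<bar> \<le> n / 4"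
        using d abs_Re_le_cmod[of "d - of_nat n"] abs_Im_le_cmod[of "d - of_nat n"] by auto
      then have "\<bar>Im d\<bar> \<le> Re d" by linarith
      then have "\<bar>Im d * Im (W z)\<bar> \<le> Re d * Re (W z)"
        unfolding abs_mult using W0 by (intro mult_mono) auto
      then have "0 \<le> Re d * Re (W z) + Im d * Im (W z)" by linarith
      then show ?thesis by (simp add: Re_divide)
    qed
    \<comment> \<open>The bound \<open>norm x \<le> norm z\<close> belongs to the invariant because
      the one-step estimates hold only in the disc of radius \<open>r\<close>; it is renewed from
      \<open>Re (W x' / W z) \<ge> 1\<close>.\<close>
    have "let x = (f ^^ n) z in x \<noteq> 0 \<and> norm (W x - W z - of_nat n) \<le> real n / 4 \<and> norm x \<le> norm z \<and>
        x = z * exp (- (Ln (W x / W z) / of_nat k))"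
    proof (induction n)
      case 0
      then show ?case using z Wnz[of z] by simp
    next
      case (Suc n)
      define x where "x = (f ^^ n) z"
      define x' where "x' = f x"
      have x: "x \<noteq> 0" "norm (W x - W z - of_nat n) \<le> real n / 4" "norm x \<le> norm z"
        "x = z * exp (- (Ln (W x / W z) / of_nat k))"
        using Suc by (auto simp: x_def Let_def)
      have x': "x' \<noteq> 0" "norm (W x' - W x - 1) < 1/4" "\<bar>Im (Ln (x' / x))\<bar> < pi / (2 * real k)"
        using step[of x] x z by (auto simp: x'_def)
      have d: "norm (W x' - W z - of_nat (Suc n)) \<le> real (Suc n) / 4"
        using norm_triangle_ineq[of "W x' - W x - 1" "W x - W z - of_nat n"] x(2) x'(2)
        by (simp add: algebra_simps)
      have quot: "W y / W z = 1 + (W y - W z) / W z" for y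
        using Wnz[OF z(1)] by (simp add: field_simps)
      have Re1: "Re (W x / W z) \<ge> 1" unfolding quot[of x] using Re_quot[OF x(2)] by simp
      have Re1': "Re (W x' / W z) \<ge> 1" unfolding quot[of x'] using Re_quot[OF d] by simp
      have "1 \<le> norm (W x' / W z)" using Re1' complex_Re_le_cmod order_trans by blast
      then have "norm (W z) \<le> norm (W x')"
        using Wnz[OF z(1)] by (simp add: norm_divide field_simps)
      then have "inverse (norm z ^ k) \<le> inverse (norm x' ^ k)"
        using b by (simp add: W_def norm_divide norm_inverse norm_power divide_le_cancel)
      then have "norm x' ^ k \<le> norm z ^ k" using z x' by simp
      then have le: "norm x' \<le> norm z" using k power_mono_iff[of "norm x'" "norm z" k] by simp
      define \<tau> where "\<tau> = x' / x"
      have \<tau>: "\<tau> \<noteq> 0" using x x' by (simp add: \<tau>_def)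
      have q: "W x / W z \<noteq> 0" "W x' / W z \<noteq> 0" using x x' z Wnz by auto
      have "W x' / W z = W x / W z * inverse (\<tau> ^ k)"
        using x x' z b by (simp add: W_def \<tau>_def power_divide field_simps)
      also have "\<dots> = exp (Ln (W x / W z)) * exp (- (of_nat k * Ln \<tau>))"
        using q \<tau> by (simp add: inverse_power_eq_exp)
      finally have "exp (Ln (W x / W z) - of_nat k * Ln \<tau>) = W x' / W z"
        by (simp add: exp_diff exp_minus divide_inverse)
      \<comment> \<open>Each of the two arguments is below \<open>pi / 2\<close> in modulus, so
        their difference stays in the principal strip and \<open>Ln\<close> is additive
        here.\<close>
      moreover have "\<bar>Im (Ln (W x / W z) - of_nat k * Ln \<tau>)\<bar> < pi"
      proof -
        have "\<bar>Im (Ln (W x / W z))\<bar> < pi / 2"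
          using Re1 q by (subst Re_Ln_pos_lt_imp) auto
        moreover have "\<bar>k * Im (Ln \<tau>)\<bar> < pi / 2"
          using x'(3) k by (simp add: abs_mult \<tau>_def field_simps)
        ultimately show ?thesis by (simp add: abs_if split: if_splits)
      qed
      ultimately have Ln_eq: "Ln (W x' / W z) = Ln (W x / W z) - of_nat k * Ln \<tau>"
        by (intro Ln_unique) auto
      have "x' = x * exp (Ln \<tau>)" using x \<tau> by (simp add: \<tau>_def)
      also have "\<dots> = z * exp (- (Ln (W x / W z) / of_nat k) + Ln \<tau>)"
        by (subst x(4)) (simp only: exp_add mult.assoc)
      also have "- (Ln (W x / W z) / of_nat k) + Ln \<tau> = - (Ln (W x' / W z) / of_nat k)"
        using k by (simp add: Ln_eq field_simps)
      finally show ?case using x' d le by (simp add: x'_def x_def)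
    qed
    moreover define d where "d = W ((f ^^ n) z) - W z"
    moreover have "1 + d / W z = W ((f ^^ n) z) / W z" using Wnz[OF z(1)] by (simp add: d_def field_simps)
    ultimately have "norm (d - of_nat n) \<le> real n / 4 \<and> norm ((f ^^ n) z) \<le> norm z \<and>
        0 \<le> Re (d / W z) \<and> (f ^^ n) z = z * exp (- (Ln (1 + d / W z) / of_nat k))"
      using Re_quot[of d n] by (simp add: Let_def)
    then show "\<exists>d. norm (d - of_nat n) \<le> real n / 4 \<and> norm ((f ^^ n) z) \<le> norm z \<and>
           0 \<le> Re (d / (inverse (z ^ k) / (- (of_nat k * a)))) \<and>
           (f ^^ n) z = z * exp (- (Ln (1 + d / (inverse (z ^ k) / (- (of_nat k * a)))) / of_nat k))"
      unfolding W_def b_def by blast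
  qed
qed

text \<open>\<open>\<zeta>\<close> is the principal value of \<open>q powr (- 1 / k)\<close>. Its
  modulus is at most 1, and its argument is that of \<open>q\<close> divided by \<open>- k\<close>:
  of the opposite sign and still below \<open>pi / 2\<close>. The sign \<open>\<sigma>\<close>
  treats both half-planes at once.\<close>

lemma exp_neg_Ln_div_bounds:
  fixes k :: nat
  assumes k: "k \<ge> 1" and q: "Re q \<ge> 1" and \<sigma>: "\<sigma> = 1 \<or> \<sigma> = - 1" and Im: "0 \<le> \<sigma> * Im q"
  defines "\<zeta> \<equiv> exp (- (Ln q / of_nat k))"
  shows "0 \<le> Re \<zeta>" "Re \<zeta> \<le> 1" "0 \<le> - \<sigma> * Im \<zeta>"
    and "norm q \<le> 4 \<Longrightarrow> 1 / 4 \<le> \<sigma> * Im q \<Longrightarrow> sin (1 / (16 * real k)) / 4 \<le> - \<sigma> * Im \<zeta>"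
proof -
  have q0: "q \<noteq> 0" using q by auto
  have nq: "norm q \<ge> 1" using q complex_Re_le_cmod[of q] by linarith
  define A where "A = Im (Ln q)"
  define B where "B = \<sigma> * A / k"
  have A: "\<bar>A\<bar> < pi / 2" unfolding A_def using q by (intro Re_Ln_pos_lt_imp) auto
  have \<sigma>A: "\<bar>\<sigma> * A\<bar> < pi / 2" using A \<sigma> by auto
  have Imq: "\<sigma> * Im q = norm q * sin (\<sigma> * A)"
    using Im_exp[of "Ln q"] q0 \<sigma> by (auto simp: A_def)
  have A0: "0 \<le> \<sigma> * A"
  proof (rule ccontr)
    assume "\<not> 0 \<le> \<sigma> * A"
    then have "0 < sin (- (\<sigma> * A))" using \<sigma>A by (intro sin_gt_zero) (auto simp: abs_less_iff)
    moreover have "0 \<le> sin (\<sigma> * A)" using Imq Im nq by (auto simp: zero_le_mult_iff)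
    ultimately show False by simp
  qed
  have "\<sigma> * A / k \<le> \<sigma> * A / 1" using A0 k by (intro divide_left_mono) auto
  then have "B \<le> \<sigma> * A" by (simp add: B_def)
  then have B: "0 \<le> B" "B < pi / 2"
    using A0 \<sigma>A abs_ge_self[of "\<sigma> * A"] by (simp add: B_def, linarith)
  have n\<zeta>: "norm \<zeta> = exp (- (ln (norm q) / k))" using q0 by (simp add: \<zeta>_def norm_exp_eq_Re)
  have cosB: "cos (A / k) = cos B" using \<sigma> by (auto simp: B_def)
  have Re\<zeta>: "Re \<zeta> = norm \<zeta> * cos B"
    unfolding n\<zeta> cosB[symmetric] \<zeta>_def Re_exp using q0 by (simp add: A_def)
  have Im\<zeta>: "- \<sigma> * Im \<zeta> = norm \<zeta> * sin B"
    unfolding n\<zeta> unfolding \<zeta>_def Im_exp B_def using q0 \<sigma> by (auto simp: A_def)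
  have le1: "norm \<zeta> \<le> 1" unfolding n\<zeta> using nq by simp
  show "0 \<le> Re \<zeta>" unfolding Re\<zeta> using B by (intro mult_nonneg_nonneg cos_ge_zero) auto
  show "Re \<zeta> \<le> 1" using le1 complex_Re_le_cmod[of \<zeta>] by linarith
  show "0 \<le> - \<sigma> * Im \<zeta>" unfolding Im\<zeta> using B pi_gt_zero by (intro mult_nonneg_nonneg sin_ge_zero) auto
  \<comment> \<open>The two bounds on \<open>q\<close> give
    \<open>sin (\<sigma> * A) \<ge> 1/16\<close>, hence the angle \<open>B\<close> is at least
    \<open>1 / (16 * k)\<close>; moreover the modulus of \<open>\<zeta>\<close> is at least the
    \<open>k\<close>-th root of \<open>1/4\<close>, hence at least \<open>1/4\<close>.\<close>
  assume q4: "norm q \<le> 4" and Im4: "1 / 4 \<le> \<sigma> * Im q"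
  have s0: "0 \<le> sin (\<sigma> * A)" using A0 \<sigma>A pi_gt_zero by (intro sin_ge_zero) auto
  have "norm q * sin (\<sigma> * A) \<le> 4 * sin (\<sigma> * A)" using q4 s0 by (rule mult_right_mono)
  then have "1 / 16 \<le> sin (\<sigma> * A)" using Im4 Imq by linarith
  also have "\<dots> \<le> \<sigma> * A" using A0 by (rule sin_x_le_x)
  finally have "1 / 16 \<le> \<sigma> * A" .
  then have "1 / (16 * real k) \<le> B" using k by (simp add: B_def field_simps)
  then have sinB: "sin (1 / (16 * real k)) \<le> sin B"
    using B k pi_gt_zero by (intro sin_monotone_2pi_le) (auto intro: order_trans[of _ 0])
  have "ln (norm q) / k \<le> ln 4 / k" using q4 nq by (intro divide_right_mono ln_mono) auto
  also have "\<dots> \<le> ln 4 / 1" using k by (intro divide_left_mono) auto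
  finally have "exp (- ln 4) \<le> norm \<zeta>" unfolding n\<zeta> by simp
  then have n4: "1 / 4 \<le> norm \<zeta>" by (simp add: exp_minus)
  have "1 / 4 * sin (1 / (16 * real k)) \<le> norm \<zeta> * sin B"
  proof (rule mult_mono[OF n4 sinB])
    have "1 / (16 * real k) \<le> 1 / (16 * 1)" using k by (intro divide_left_mono) auto
    then have "1 / (16 * real k) \<le> pi" using pi_gt3 by linarith
    then show "0 \<le> sin (1 / (16 * real k))" by (intro sin_ge_zero) auto
  qed simp
  then show "sin (1 / (16 * real k)) / 4 \<le> - \<sigma> * Im \<zeta>" unfolding Im\<zeta> by simp
qed

text \<open>Because \<open>a * v ^ k = - 1\<close>, the number \<open>- k * a * z ^ k\<close> is
  \<open>k * \<rho> ^ k\<close> rotated by \<open>k * \<alpha>\<close>; on the attracting direction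
  itself \<open>W\<close> is real and positive.\<close>

lemma inverse_power_cis:
  fixes \<alpha> \<rho> :: real
  assumes "a * v ^ k = - 1" "\<rho> > 0" "k \<ge> 1" "z = v * of_real \<rho> * cis \<alpha>"
  shows "inverse (z ^ k) / (- (of_nat k * a)) = cis (- (k * \<alpha>)) / of_real (k * \<rho> ^ k)"
proof -
  have "- (of_nat k * a) * z ^ k = - (of_nat k * (a * v ^ k) * of_real \<rho> ^ k * cis \<alpha> ^ k)"
    by (simp add: assms(4) power_mult_distrib)
  also have "\<dots> = of_real (k * \<rho> ^ k) * cis (k * \<alpha>)"
    by (simp add: assms(1) Complex.DeMoivre)
  finally have "inverse (z ^ k) / (- (of_nat k * a)) = inverse (of_real (k * \<rho> ^ k) * cis (k * \<alpha>))"
    by (metis divide_inverse inverse_mult_distrib mult.commute)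
  then show ?thesis by (simp add: cis_inverse divide_inverse mult.commute)
qed

text \<open>At an angle of at most \<open>pi / (4 * k)\<close> from the attracting direction,
  \<open>W\<close> has an argument of at most \<open>pi / 4\<close> in modulus, which is the sector
  in which \<open>parabolic_orbit\<close> applies.\<close>

lemma parabolic_orbit_on_ray:
  assumes f: "parabolic_leading_term f k a" and v: "a * v ^ k = - 1"
  obtains r where "r > 0" 
    "\<And>z (\<alpha>::real) (\<rho>::real) n. z = v * of_real \<rho> * cis \<alpha> \<Longrightarrow> \<rho> > 0 \<Longrightarrow> norm z < r \<Longrightarrow> \<bar>\<alpha>\<bar> \<le> pi / (4 * real k)
      \<Longrightarrow> norm ((f ^^ n) z) \<le> norm z"
    "\<And>z (\<alpha>::real) (\<rho>::real) n. z = v * of_real \<rho> * cis \<alpha> \<Longrightarrow> \<rho> > 0 \<Longrightarrow> norm z < r \<Longrightarrow> \<bar>\<alpha>\<bar> \<le> pi / (4 * real k)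
      \<Longrightarrow> \<exists>d. norm (d - of_nat n) \<le> real n / 4 \<and> 
           0 \<le> Re (d * cis (k * \<alpha>)) \<and>
           (f ^^ n) z = z * exp (- (Ln (1 + of_real (k * \<rho> ^ k) * d * cis (k * \<alpha>)) / of_nat k))"
proof -
  have k: "k \<ge> 1" using f by (simp add: parabolic_leading_term_def)
  obtain r where r: "r > 0" and orbit:
    "\<And>z n. z \<noteq> 0 \<Longrightarrow> norm z < r \<Longrightarrow> \<bar>Im (inverse (z ^ k) / (- (of_nat k * a)))\<bar> \<le> Re (inverse (z ^ k) / (- (of_nat k * a)))
      \<Longrightarrow> \<exists>d. norm (d - of_nat n) \<le> real n / 4 \<and> norm ((f ^^ n) z) \<le> norm z \<and>
           0 \<le> Re (d / (inverse (z ^ k) / (- (of_nat k * a)))) \<and>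
           (f ^^ n) z = z * exp (- (Ln (1 + d / (inverse (z ^ k) / (- (of_nat k * a)))) / of_nat k))"
    using parabolic_orbit[OF f] by blast
  have v0: "v \<noteq> 0" using v k by (auto simp: power_0_left)
  have *: "\<exists>d. norm (d - of_nat n) \<le> real n / 4 \<and> norm ((f ^^ n) z) \<le> norm z \<and>
           0 \<le> Re (d * cis (k * \<alpha>)) \<and>
           (f ^^ n) z = z * exp (- (Ln (1 + of_real (k * \<rho> ^ k) * d * cis (k * \<alpha>)) / of_nat k))"
    if z: "z = v * of_real \<rho> * cis \<alpha>" "\<rho> > 0" "norm z < r" "\<bar>\<alpha>\<bar> \<le> pi / (4 * real k)" for z n and \<alpha> \<rho> :: real
  proof -
    define W where "W = inverse (z ^ k) / (- (of_nat k * a))"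
    have W: "W = cis (- (k * \<alpha>)) / of_real (k * \<rho> ^ k)"
      unfolding W_def by (rule inverse_power_cis) (use v z k in auto)
    have \<kappa>: "k * \<rho> ^ k > 0" using k z by simp
    have "\<bar>k * \<alpha>\<bar> \<le> pi / 4" using z(4) k by (simp add: abs_mult field_simps)
    then have "\<bar>sin (k * \<alpha>)\<bar> \<le> cos (k * \<alpha>)"
    proof -
      have "\<bar>sin (k * \<alpha>)\<bar> = sin \<bar>k * \<alpha>\<bar>"
        using \<open>\<bar>k * \<alpha>\<bar> \<le> pi / 4\<close> pi_gt_zero sin_ge_zero[of "\<bar>k * \<alpha>\<bar>"]
        by (cases "k * \<alpha> \<ge> 0") auto
      also have "\<dots> \<le> sin (pi / 4)"
        using \<open>\<bar>k * \<alpha>\<bar> \<le> pi / 4\<close> pi_gt_zero by (intro sin_monotone_2pi_le) (auto intro: order_trans[of _ 0])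
      also have "\<dots> = cos (pi / 4)" by (simp add: sin_45 cos_45)
      also have "\<dots> \<le> cos \<bar>k * \<alpha>\<bar>"
        using \<open>\<bar>k * \<alpha>\<bar> \<le> pi / 4\<close> pi_gt_zero by (intro cos_monotone_0_pi_le) auto
      finally show ?thesis by simp
    qed
    then have "\<bar>Im W\<bar> \<le> Re W"
      unfolding W using \<kappa> by (simp add: Re_divide_of_real Im_divide_of_real divide_right_mono abs_divide)
    moreover have dW: "d / W = of_real (k * \<rho> ^ k) * d * cis (k * \<alpha>)" for d
      unfolding W by (simp add: divide_inverse mult_ac)
    moreover have "0 \<le> Re (d * cis (k * \<alpha>))" if "0 \<le> Re (d / W)" for d
    proof -
      have "0 \<le> (k * \<rho> ^ k) * Re (d * cis (k * \<alpha>))" using that unfolding dW mult.assoc[of _ d]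
        by (simp only: scaleR_conv_of_real[symmetric] scaleR_complex.sel)
      then show ?thesis using \<kappa> by (simp add: zero_le_mult_iff)
    qed
    moreover have "z \<noteq> 0" using z v0 by simp
    ultimately show ?thesis using orbit[of z n] z(3) unfolding W_def[symmetric] by metis
  qed
  show ?thesis by (rule that[OF r]) (use * in blast)+
qed

section \<open>Directed area on rays beside the attracting direction\<close>

text \<open>The neighbourhood is bounded and contains a ball, so its area is finite and positive and
  cancels against the denominator of the center of mass; neither \<open>measure\<close> of an
  infinite set nor division by 0 takes its default value.\<close>

lemma directed_area_eq_moment:
  assumes "\<epsilon> > 0" "orbit_of f z \<subseteq> cball 0 t"
  shows "directed_area f \<epsilon> z = (LINT w:eps_nbhd \<epsilon> (orbit_of f z)|lborel. w)"
proof -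
  let ?N = "eps_nbhd \<epsilon> (orbit_of f z)"
  have "z \<in> orbit_of f z" unfolding orbit_of_def by (auto intro: exI[of _ 0])
  then have "ball z \<epsilon> \<subseteq> ?N" by (auto simp: eps_nbhd_def)
  moreover have "?N \<in> fmeasurable lborel"
    using eps_nbhd_subset_ball[OF assms(2), of \<epsilon>] open_eps_nbhd[of \<epsilon> "orbit_of f z"]
    by (intro bounded_fmeasurable) auto
  ultimately have "measure lborel (ball z \<epsilon>) \<le> area ?N"
    unfolding area_def by (intro measure_mono_fmeasurable) auto
  moreover have "measure lborel (ball z \<epsilon>) > 0" using assms by (simp add: measure_complex_ball)
  ultimately have "area ?N \<noteq> 0" by linarith
  then show ?thesis by (simp add: directed_area_def center_of_mass_def)
qed

text \<open>On these rays the coordinate \<open>W\<close> starts with argument \<open>- \<sigma> * pi / 4\<close> and moves to the right,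
  so its argument tends to \<open>0\<close> and \<open>z * (W / W\<^sub>0) powr (- 1 / k)\<close> stays on one side of the line
  through \<open>0\<close> and \<open>z\<close>.  The point that is far from this line has an index of the order of the
  modulus of \<open>W\<^sub>0\<close>.\<close>

lemma orbit_one_side_of_chord:
  assumes f: "parabolic_leading_term f k a" and v: "a * v ^ k = - 1" and \<sigma>: "\<sigma> = 1 \<or> \<sigma> = - 1"
  obtains r \<delta> where "r > 0" "0 < \<delta>" "\<delta> \<le> 1"
    "\<And>z (\<rho>::real) n. z = v * of_real \<rho> * cis (\<sigma> * (pi / (4 * real k))) \<Longrightarrow> \<rho> > 0 \<Longrightarrow> norm z < r \<Longrightarrow>
      0 \<le> Re ((f ^^ n) z / z) \<and> Re ((f ^^ n) z / z) \<le> 1 \<and> 0 \<le> - \<sigma> * Im ((f ^^ n) z / z)"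
    "\<And>z (\<rho>::real). z = v * of_real \<rho> * cis (\<sigma> * (pi / (4 * real k))) \<Longrightarrow> \<rho> > 0 \<Longrightarrow> norm z < r \<Longrightarrow>
      \<exists>n. \<delta> \<le> - \<sigma> * Im ((f ^^ n) z / z)"
proof -
  have k: "k \<ge> 1" using f by (simp add: parabolic_leading_term_def)
  have v0: "v \<noteq> 0" using v k by (auto simp: power_0_left)
  obtain r where r: "r > 0" and orbit:
    "\<And>z (\<alpha>::real) (\<rho>::real) n. z = v * of_real \<rho> * cis \<alpha> \<Longrightarrow> \<rho> > 0 \<Longrightarrow> norm z < r \<Longrightarrow> \<bar>\<alpha>\<bar> \<le> pi / (4 * real k)
      \<Longrightarrow> \<exists>d. norm (d - of_nat n) \<le> real n / 4 \<and> 
           0 \<le> Re (d * cis (k * \<alpha>)) \<and>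
           (f ^^ n) z = z * exp (- (Ln (1 + of_real (k * \<rho> ^ k) * d * cis (k * \<alpha>)) / of_nat k))"
    using parabolic_orbit_on_ray[OF f v] by metis
  define \<delta> where "\<delta> = sin (1 / (16 * real k)) / 4"
  have "1 / (16 * real k) \<le> 1 / (16 * 1)" using k by (intro divide_left_mono) auto
  then have "1 / (16 * real k) < pi" using pi_gt3 by linarith
  then have "0 < sin (1 / (16 * real k))" using k by (intro sin_gt_zero) auto
  then have \<delta>: "0 < \<delta>" "\<delta> \<le> 1" using sin_le_one[of "1 / (16 * real k)"] unfolding \<delta>_def by linarith+
  \<comment> \<open>The second bound forces \<open>\<rho> < 1 / k\<close>, hence
    \<open>k * \<rho> ^ k \<le> 1\<close>, so that some multiple of this step length falls between 1
    and 2.\<close>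
  define r' where "r' = min r (norm v / k)"
  have r': "r' > 0" using r v0 k by (simp add: r'_def)
  have main: "0 \<le> Re ((f ^^ n) z / z) \<and> Re ((f ^^ n) z / z) \<le> 1 \<and> 0 \<le> - \<sigma> * Im ((f ^^ n) z / z)
      \<and> (1 \<le> n * (k * \<rho> ^ k) \<longrightarrow> n * (k * \<rho> ^ k) \<le> 2 \<longrightarrow> \<delta> \<le> - \<sigma> * Im ((f ^^ n) z / z))"
    if z: "z = v * of_real \<rho> * cis (\<sigma> * (pi / (4 * real k)))" "\<rho> > 0" "norm z < r'" for z n and \<rho> :: real
  proof -
    define \<kappa> where "\<kappa> = k * \<rho> ^ k"
    have \<kappa>: "\<kappa> > 0" using k z by (simp add: \<kappa>_def)
    have "k * (\<sigma> * (pi / (4 * real k))) = \<sigma> * (pi / 4)" using k by simp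
    then have "\<exists>d. norm (d - of_nat n) \<le> real n / 4 \<and> 0 \<le> Re (d * cis (\<sigma> * (pi / 4))) \<and>
           (f ^^ n) z = z * exp (- (Ln (1 + of_real \<kappa> * d * cis (\<sigma> * (pi / 4))) / of_nat k))"
      using orbit[OF z(1,2), of n] z(3) \<sigma> k unfolding \<kappa>_def by (auto simp: r'_def)
    then obtain d where d: "norm (d - of_nat n) \<le> real n / 4" "0 \<le> Re (d * cis (\<sigma> * (pi / 4)))"
       "(f ^^ n) z = z * exp (- (Ln (1 + of_real \<kappa> * d * cis (\<sigma> * (pi / 4))) / of_nat k))" by blast
    define q where "q = 1 + of_real \<kappa> * d * cis (\<sigma> * (pi / 4))"
    have z0: "z \<noteq> 0" using z v0 by simp
    have \<zeta>: "(f ^^ n) z / z = exp (- (Ln q / of_nat k))" using d(3) z0 by (simp add: q_def)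
    have q: "q = 1 + \<kappa> *\<^sub>R (d * cis (\<sigma> * (pi / 4)))"
      by (simp add: q_def scaleR_conv_of_real mult.assoc)
    have Req: "1 \<le> Re q"
      unfolding q plus_complex.sel scaleR_complex.sel using d(2) \<kappa> by (simp add: mult_nonneg_nonneg del: times_complex.sel)
    \<comment> \<open>The displacement is close enough to the positive axis that, after rotation by
      \<open>\<sigma> * pi / 4\<close>, its imaginary part in the direction \<open>\<sigma>\<close>
      is at least \<open>n / 4\<close>.\<close>
    have "\<bar>Re d - n\<bar> \<le> n / 4" "\<bar>Im d\<bar> \<le> n / 4"
      using d abs_Re_le_cmod[of "d - of_nat n"] abs_Im_le_cmod[of "d - of_nat n"] by auto
    then have "n / 2 \<le> Re d + \<sigma> * Im d" using \<sigma> by (elim disjE; hypsubst; linarith)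
    moreover have "\<sigma> * Im (d * cis (\<sigma> * (pi / 4))) = (sqrt 2 / 2) * (Re d + \<sigma> * Im d)"
      using \<sigma> by (elim disjE) (simp_all add: sin_45 cos_45 algebra_simps)
    moreover have "1 / 2 \<le> sqrt 2 / 2" by simp
    ultimately have "1 / 2 * (n / 2) \<le> \<sigma> * Im (d * cis (\<sigma> * (pi / 4)))"
      using mult_mono[of "1/2" "sqrt 2 / 2" "n / 2" "Re d + \<sigma> * Im d"] by simp
    then have "\<kappa> * (n / 4) \<le> \<kappa> * (\<sigma> * Im (d * cis (\<sigma> * (pi / 4))))"
      using \<kappa> by (intro mult_left_mono) auto
    also have "\<dots> = \<sigma> * Im q" unfolding q plus_complex.sel scaleR_complex.sel by (simp add: mult.left_commute del: times_complex.sel)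
    finally have Imq: "n * \<kappa> / 4 \<le> \<sigma> * Im q" by (simp add: mult.commute)
    have Imq0: "0 \<le> \<sigma> * Im q" using Imq \<kappa> by (intro order_trans[OF _ Imq]) auto
    have nq: "norm q \<le> 4" if "n * \<kappa> \<le> 2"
    proof -
      have "norm d \<le> 5/4 * n" using norm_triangle_ineq[of "d - of_nat n" "of_nat n"] d(1) by simp
      then have "\<kappa> * norm d \<le> \<kappa> * (5/4 * n)" using \<kappa> by (intro mult_left_mono) auto
      moreover have "norm q \<le> 1 + \<kappa> * norm d"
        unfolding q_def using \<kappa> by (intro order_trans[OF norm_triangle_ineq]) (simp add: norm_mult)
      ultimately show ?thesis using that by (simp add: algebra_simps)
    qed
    show ?thesis
      unfolding \<zeta> \<kappa>_def[symmetric] \<delta>_def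
      using exp_neg_Ln_div_bounds[OF k Req \<sigma> Imq0] Imq nq by auto
  qed
  show ?thesis
  proof (rule that[OF r' \<delta>])
    fix z and \<rho> :: real assume z: "z = v * of_real \<rho> * cis (\<sigma> * (pi / (4 * real k)))" "\<rho> > 0" "norm z < r'"
    define \<kappa> where "\<kappa> = k * \<rho> ^ k"
    have "norm v * \<rho> < norm v / k" using z by (auto simp: r'_def norm_mult)
    then have "norm v * \<rho> < norm v * (1 / k)" by simp
    then have \<rho>: "\<rho> < 1 / k" using v0 by (subst (asm) mult_less_cancel_left_pos) auto
    moreover have "1 / real k \<le> 1" using k by simp
    ultimately have "\<rho> \<le> 1" by linarith
    then have "\<rho> ^ k \<le> \<rho> ^ 1" using z(2) k by (intro power_decreasing) auto
    with \<rho> have "\<rho> ^ k \<le> 1 / k" by simp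
    then have \<kappa>: "0 < \<kappa>" "\<kappa> \<le> 1" using k z by (auto simp: \<kappa>_def field_simps)
    \<comment> \<open>With this index \<open>n * \<kappa>\<close> lies between 1 and 2: the lower
      bound gives \<open>\<sigma> * Im q \<ge> 1/4\<close>, the upper one
      \<open>norm q \<le> 4\<close>.\<close>
    define n where "n = nat \<lceil>1 / \<kappa>\<rceil>"
    have "1 / \<kappa> \<le> n" "n \<le> 1 / \<kappa> + 1" using \<kappa> by (auto simp: n_def le_of_int_ceiling)
    then have "1 \<le> n * \<kappa>" "n * \<kappa> \<le> 2" using \<kappa> by (auto simp: field_simps)
    then show "\<exists>n. \<delta> \<le> - \<sigma> * Im ((f ^^ n) z / z)" using main[OF z, of n] by (auto simp: \<kappa>_def)
  qed (use main in blast)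
qed

text \<open>The orbit is a set to which \<open>moment_eps_nbhd_ge\<close> applies with
  \<open>t = norm z\<close>. The component of the moment normal to the chord is \<open>t\<close>
  times the imaginary part of its quotient by \<open>z\<close>, up to sign, so the bound
  \<open>c * t\<close> turns into a constant independent of \<open>z\<close>.\<close>

lemma Im_directed_area_quot_ge:
  assumes f: "parabolic_leading_term f k a" and v: "a * v ^ k = - 1" and \<sigma>: "\<sigma> = 1 \<or> \<sigma> = - 1"
    and \<epsilon>: "\<epsilon> > 0"
  obtains r c where "r > 0" "c > 0"
    "\<And>z (\<rho>::real). z = v * of_real \<rho> * cis (\<sigma> * (pi / (4 * real k))) \<Longrightarrow> \<rho> > 0 \<Longrightarrow> norm z < r \<Longrightarrow>
      (\<lambda>n. (f ^^ n) z) \<longlonglongrightarrow> 0 \<Longrightarrow> c \<le> - \<sigma> * Im (directed_area f \<epsilon> z / z)"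
proof -
  have k: "k \<ge> 1" using f by (simp add: parabolic_leading_term_def)
  have v0: "v \<noteq> 0" using v k by (auto simp: power_0_left)
  obtain r1 where r1: "r1 > 0" "\<And>z (\<alpha>::real) (\<rho>::real) n. z = v * of_real \<rho> * cis \<alpha> \<Longrightarrow> \<rho> > 0 \<Longrightarrow> norm z < r1 \<Longrightarrow>
      \<bar>\<alpha>\<bar> \<le> pi / (4 * real k) \<Longrightarrow> norm ((f ^^ n) z) \<le> norm z"
    using parabolic_orbit_on_ray[OF f v] by metis
  obtain r2 \<delta> where r2: "r2 > 0" and \<delta>: "0 < \<delta>" "\<delta> \<le> 1" and side:
    "\<And>z (\<rho>::real) n. z = v * of_real \<rho> * cis (\<sigma> * (pi / (4 * real k))) \<Longrightarrow> \<rho> > 0 \<Longrightarrow> norm z < r2 \<Longrightarrow>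
      0 \<le> Re ((f ^^ n) z / z) \<and> Re ((f ^^ n) z / z) \<le> 1 \<and> 0 \<le> - \<sigma> * Im ((f ^^ n) z / z)"
    and far: "\<And>z (\<rho>::real). z = v * of_real \<rho> * cis (\<sigma> * (pi / (4 * real k))) \<Longrightarrow> \<rho> > 0 \<Longrightarrow> norm z < r2 \<Longrightarrow>
      \<exists>n. \<delta> \<le> - \<sigma> * Im ((f ^^ n) z / z)"
    using orbit_one_side_of_chord[OF f v \<sigma>] by blast
  define e where "e = sgn v * cis (\<sigma> * (pi / (4 * real k)))"
  have e: "norm e = 1" using v0 by (simp add: e_def norm_mult norm_sgn)
  then have ee: "e * cnj e = 1" by (simp add: complex_norm_square[symmetric])
  \<comment> \<open>Coordinates rotated so that the ray through \<open>z\<close> is the positive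
    half of the axis \<open>L = 0\<close>; the factor \<open>- \<sigma>\<close> orients
    \<open>L\<close> towards the attracting direction.\<close>
  define P where "P = (\<lambda>w. Re (w * cnj e))"
  define L where "L = (\<lambda>w. - \<sigma> * Im (w * cnj e))"
  have P: "bounded_linear P" unfolding P_def
    by (intro bounded_linear_compose[OF bounded_linear_Re] bounded_linear_mult_left)
  have L: "bounded_linear L" unfolding L_def
    by (intro bounded_linear_compose[OF bounded_linear_mult_right]
        bounded_linear_compose[OF bounded_linear_Im] bounded_linear_mult_left)
  have PL: "(norm w)\<^sup>2 = (P w)\<^sup>2 + (L w)\<^sup>2" for w
  proof -
    have "(norm w)\<^sup>2 = (norm (w * cnj e))\<^sup>2" using e by (simp add: norm_mult)
    also have "\<dots> = (P w)\<^sup>2 + (L w)\<^sup>2"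
      unfolding P_def L_def cmod_power2 using \<sigma> by (auto simp: power_mult_distrib)
    finally show ?thesis .
  qed
  define u where "u = of_real (- \<sigma>) * \<i> * e"
  have "u * cnj e = of_real (- \<sigma>) * \<i>" unfolding u_def by (simp only: mult.assoc ee mult_1_right)
  then have u: "P u = 0" "L u = 1" unfolding P_def L_def using \<sigma> by auto
  obtain c t0 where c: "c > 0" "t0 > 0" and moment:
    "\<And>X z y t. 0 < t \<Longrightarrow> t < t0 \<Longrightarrow> z \<in> X \<Longrightarrow> 0 \<in> closure X \<Longrightarrow> P z = t \<Longrightarrow> L z = 0 \<Longrightarrow>
       (\<And>x. x \<in> X \<Longrightarrow> 0 \<le> P x \<and> P x \<le> t \<and> 0 \<le> L x \<and> norm x \<le> t) \<Longrightarrow>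
       y \<in> X \<Longrightarrow> \<delta> * t \<le> L y \<Longrightarrow> c * t \<le> L (LINT w:eps_nbhd \<epsilon> X|lborel. w)"
    using moment_eps_nbhd_ge[OF P L PL u \<epsilon> \<delta>] by blast
  show ?thesis
  proof (rule that[of "min t0 (min r1 r2)" c])
    fix z and \<rho> :: real
    assume z: "z = v * of_real \<rho> * cis (\<sigma> * (pi / (4 * real k)))" "\<rho> > 0" "norm z < min t0 (min r1 r2)"
      and lim: "(\<lambda>n. (f ^^ n) z) \<longlonglongrightarrow> 0"
    define t where "t = norm z"
    have t: "0 < t" "t < t0" "t < r1" "t < r2" using z v0 by (auto simp: t_def)
    have zt: "z = of_real t * e"
      using z(2) v0 unfolding t_def e_def z(1)
      by (simp add: norm_mult sgn_eq)
    have P_eq: "P (z * \<zeta>) = t * Re \<zeta>" and L_eq: "L (z * \<zeta>) = t * (- \<sigma> * Im \<zeta>)" for \<zeta>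
    proof -
      have "z * \<zeta> * cnj e = of_real t * \<zeta> * (e * cnj e)" by (simp add: zt mult_ac)
      then have eq: "z * \<zeta> * cnj e = of_real t * \<zeta>" by (simp add: ee)
      then show "P (z * \<zeta>) = t * Re \<zeta>" "L (z * \<zeta>) = t * (- \<sigma> * Im \<zeta>)"
        unfolding P_def L_def eq by simp_all
    qed
    have quot: "z * (w / z) = w" for w using t by (auto simp: t_def)
    have le: "norm ((f ^^ n) z) \<le> t" for n
      unfolding t_def using \<sigma> k t by (intro r1(2)[OF z(1,2)]) (auto simp: t_def)
    have Xt: "orbit_of f z \<subseteq> cball 0 t" using le by (auto simp: orbit_of_def)
    obtain n where n: "\<delta> \<le> - \<sigma> * Im ((f ^^ n) z / z)" using far[OF z(1,2)] t by (auto simp: t_def)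
    have "c * t \<le> L (LINT w:eps_nbhd \<epsilon> (orbit_of f z)|lborel. w)"
    proof (rule moment)
      show "z \<in> orbit_of f z" unfolding orbit_of_def by (auto intro: exI[of _ 0])
      show "0 \<in> closure (orbit_of f z)"
        unfolding closure_sequential using lim by (auto simp: orbit_of_def)
      show "P z = t" "L z = 0" using P_eq[of 1] L_eq[of 1] by auto
      show "(f ^^ n) z \<in> orbit_of f z" by (auto simp: orbit_of_def)
      show "\<delta> * t \<le> L ((f ^^ n) z)"
        using L_eq[of "(f ^^ n) z / z", unfolded quot] mult_left_mono[OF n, of t] t by (simp add: mult.commute)
      fix x assume "x \<in> orbit_of f z"
      then obtain m where x: "x = (f ^^ m) z" by (auto simp: orbit_of_def)
      have *: "0 \<le> Re (x / z) \<and> Re (x / z) \<le> 1 \<and> 0 \<le> - \<sigma> * Im (x / z)"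
        unfolding x using side[OF z(1,2)] t by (simp add: t_def)
      have "P x = t * Re (x / z)" "L x = t * (- \<sigma> * Im (x / z))"
        using P_eq[of "x / z"] L_eq[of "x / z"] by (simp_all only: quot)
      then show "0 \<le> P x \<and> P x \<le> t \<and> 0 \<le> L x \<and> norm x \<le> t"
        using * t le[of m] mult_left_mono[of "Re (x / z)" 1 t] mult_nonneg_nonneg[of t "- \<sigma> * Im (x / z)"]
        by (auto simp: x)
    qed (use t in auto)
    also have "\<dots> = L (directed_area f \<epsilon> z)"
      by (simp add: directed_area_eq_moment[OF \<epsilon> Xt])
    also have "\<dots> = t * (- \<sigma> * Im (directed_area f \<epsilon> z / z))"
      using L_eq[of "directed_area f \<epsilon> z / z"] by (simp only: quot)
    finally have "t * c \<le> t * (- \<sigma> * Im (directed_area f \<epsilon> z / z))" by (simp add: mult.commute)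
    then show "c \<le> - \<sigma> * Im (directed_area f \<epsilon> z / z)" using t by (simp only: mult_le_cancel_left_pos)
  qed (use c r1 r2 in auto)
qed

section \<open>Contradiction with analyticity on petals\<close>

text \<open>If \<open>g\<close> is a primitive of \<open>G\<close>, then \<open>g (x + \<i> \<phi>) - g (x - \<i> \<phi>)\<close> is bounded, yet the
  derivative of its imaginary part is at most \<open>- 2 c\<close>.\<close>

lemma not_holomorphic_half_strip:
  fixes G :: "complex \<Rightarrow> complex"
  assumes \<phi>: "0 < \<phi>" "\<phi> < \<psi>" and "c > 0"
    and bound: "\<And>s. Re s < B \<Longrightarrow> \<bar>Im s\<bar> \<le> \<phi> \<Longrightarrow> norm (G s) \<le> C"
    and upper: "\<And>x. x < B \<Longrightarrow> c \<le> - Im (G (Complex x \<phi>))"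
    and lower: "\<And>x. x < B \<Longrightarrow> c \<le> Im (G (Complex x (- \<phi>)))"
  shows "\<not> G holomorphic_on {s. Re s < B \<and> \<bar>Im s\<bar> < \<psi>}"
proof
  let ?S = "{s. Re s < B \<and> \<bar>Im s\<bar> < \<psi>}" and ?K = "{s. Re s < B \<and> \<bar>Im s\<bar> \<le> \<phi>}"
  assume hol: "G holomorphic_on ?S"
  have S_eq: "?S = {s. Re s < B} \<inter> {s. Im s < \<psi>} \<inter> {s. Im s > - \<psi>}"
    and K_eq: "?K = {s. Re s < B} \<inter> {s. Im s \<le> \<phi>} \<inter> {s. Im s \<ge> - \<phi>}" by (auto simp: abs_less_iff abs_le_iff)
  have opS: "open ?S" unfolding S_eq
    by (intro open_Int open_halfspace_Re_lt open_halfspace_Im_lt open_halfspace_Im_gt)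
  have "convex ?S" unfolding S_eq
    by (intro convex_Int convex_halfspace_Re_lt convex_halfspace_Im_lt convex_halfspace_Im_gt)
  from holomorphic_convex_primitive'[OF this opS hol] obtain g where
    "\<And>s. s \<in> ?S \<Longrightarrow> (g has_field_derivative G s) (at s within ?S)" by blast
  then have g: "(g has_field_derivative G s) (at s)" if "s \<in> ?S" for s
    using that at_within_open[OF that opS] by metis
  have convK: "convex ?K" unfolding K_eq
    by (intro convex_Int convex_halfspace_Re_lt convex_halfspace_Im_le convex_halfspace_Im_ge)
  have D: "norm (g (Complex x \<phi>) - g (Complex x (- \<phi>))) \<le> C * (2 * \<phi>)" if "x < B" for x
  proof -
    have "norm (g (Complex x \<phi>) - g (Complex x (- \<phi>))) \<le> C * norm (Complex x \<phi> - Complex x (- \<phi>))"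
    proof (rule field_differentiable_bound[OF convK])
      fix s assume "s \<in> ?K"
      then show "norm (G s) \<le> C" "(g has_field_derivative G s) (at s within ?K)"
        using \<phi> by (auto intro!: has_field_derivative_at_within[OF g] bound)
    qed (use that \<phi> in auto)
    also have "Complex x \<phi> - Complex x (- \<phi>) = of_real (2 * \<phi>) * \<i>" by (simp add: complex_eq_iff)
    finally show ?thesis using \<phi> by (simp add: norm_mult)
  qed
  \<comment> \<open>The factor \<open>\<i>\<close> turns minus the imaginary part of the difference
    into a real part, the form in which the mean value theorem on segments is applied.\<close>
  define h where "h = (\<lambda>s. \<i> * (g (s + of_real \<phi> * \<i>) - g (s - of_real \<phi> * \<i>)))"
  define h' where "h' = (\<lambda>s. \<i> * (G (s + of_real \<phi> * \<i>) - G (s - of_real \<phi> * \<i>)))"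
  have shift: "of_real x + of_real \<phi> * \<i> = Complex x \<phi>" "of_real x - of_real \<phi> * \<i> = Complex x (- \<phi>)" for x
    by (auto simp: complex_eq_iff)
  have h: "(h has_field_derivative h' s) (at s)" if "Re s < B" "Im s = 0" for s
  proof -
    have "((\<lambda>s. g (s + of_real b * \<i>)) has_field_derivative G (s + of_real b * \<i>)) (at s)"
      if "\<bar>b\<bar> < \<psi>" for b
      unfolding DERIV_shift[symmetric] using \<open>Re s < B\<close> \<open>Im s = 0\<close> that by (intro g) simp
    from this[of \<phi>] this[of "- \<phi>"] \<phi> show ?thesis
      unfolding h_def h'_def by (auto intro!: DERIV_cmult DERIV_diff)
  qed
  \<comment> \<open>Over a length \<open>T\<close> the real part of \<open>h\<close> grows by at
    least \<open>2 * c * T\<close>, while \<open>h\<close> is bounded by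
    \<open>2 * \<phi> * C\<close>; the summand 1 makes the growth exceed twice this bound.\<close>
  define T where "T = 2 * \<phi> * C / c + 1"
  have "0 \<le> C" using \<phi> by (intro order_trans[OF norm_ge_zero bound[of "of_real (B - 1)"]]) auto
  then have T: "T > 0" using \<phi> \<open>c > 0\<close> by (simp add: T_def add_nonneg_pos)
  define x where "x = B - 1"
  have seg: "closed_segment (of_real (x - T)) (complex_of_real x) = of_real ` {x - T..x}"
    unfolding closed_segment_of_real using T by (simp add: closed_segment_eq_real_ivl)
  have "\<exists>u. u \<in> closed_segment (of_real (x - T)) (of_real x) \<and>
      Re (h (of_real x)) - Re (h (of_real (x - T))) = Re (h' u * (of_real x - of_real (x - T)))"
  proof (rule complex_mvt_line)
    fix u assume "u \<in> closed_segment (of_real (x - T)) (complex_of_real x)"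
    then show "(h has_field_derivative h' u) (at u)"
      unfolding seg by (intro h) (auto simp: x_def)
  qed
  then obtain u where "u \<in> closed_segment (of_real (x - T)) (complex_of_real x)"
    and eq: "Re (h (of_real x)) - Re (h (of_real (x - T))) = Re (h' u * (of_real x - of_real (x - T)))" by blast
  then obtain y where y: "u = of_real y" "y < B"
    unfolding seg by (auto simp: x_def)
  have "2 * c \<le> Re (h' u)"
    unfolding h'_def y shift using upper[OF y(2)] lower[OF y(2)] by simp
  then have "T * (2 * c) \<le> T * Re (h' u)" using T by (intro mult_left_mono) auto
  also have "\<dots> = Re (h (of_real x)) - Re (h (of_real (x - T)))" unfolding eq by simp
  also have "\<dots> \<le> norm (h (of_real x)) + norm (h (of_real (x - T)))"
    using abs_Re_le_cmod[of "h (of_real x)"] abs_Re_le_cmod[of "h (of_real (x - T))"] by linarith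
  also have "\<dots> \<le> C * (2 * \<phi>) + C * (2 * \<phi>)"
    unfolding h_def shift norm_mult using D[of x] D[of "x - T"] T by (auto simp: x_def intro!: add_mono)
  finally have "T * c \<le> C * (2 * \<phi>)" by simp
  moreover have "T * c = C * (2 * \<phi>) + c" using \<open>c > 0\<close> by (simp add: T_def field_simps)
  ultimately show False using \<open>c > 0\<close> by simp
qed

text \<open>The substitution \<open>z = v * exp s\<close> maps a half-strip to a sector near 0 and
  turns \<open>F z / z\<^sup>2\<close> times \<open>dz\<close> into \<open>G s\<close> times
  \<open>ds\<close> with \<open>G s = F z / z\<close>. The moment estimates make \<open>G\<close>
  bounded, with imaginary parts of opposite sign and away from 0 on the lines
  \<open>Im s = \<phi>\<close> and \<open>Im s = - \<phi>\<close>.\<close>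

lemma directed_area_not_holomorphic:
  assumes "attracting_petal U f V" "\<epsilon> > 0"
  shows "\<not> directed_area f \<epsilon> holomorphic_on V"
proof
  assume hol: "directed_area f \<epsilon> holomorphic_on V"
  have lim: "(\<lambda>n. (f ^^ n) z) \<longlonglongrightarrow> 0" if "z \<in> V" for z
    using assms(1) that by (simp add: attracting_petal_def)
  obtain k a v where f: "parabolic_leading_term f k a" and v: "a * v ^ k = - 1"
    and sectors: "\<forall>\<delta>. 0 < \<delta> \<and> \<delta> < pi / real k \<longrightarrow> (\<exists>r>0. sector v (pi / real k - \<delta>) r \<subseteq> V)"
    using assms(1) unfolding attracting_petal_def by (elim conjE exE) (rule that)
  have k: "k \<ge> 1" using f by (simp add: parabolic_leading_term_def)
  have v0: "v \<noteq> 0" using v k by (auto simp: power_0_left)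
  \<comment> \<open>The angle of the two rays. The sector of half-angle
    \<open>2 * \<phi> = pi / (2 * k)\<close> contains them in its interior and, near 0, lies in the
    petal; as \<open>2 * \<phi> < pi\<close>, the principal argument of \<open>exp s\<close> is
    \<open>Im s\<close> on the strip.\<close>
  define \<phi> where "\<phi> = pi / (4 * real k)"
  have "pi / (4 * real k) \<le> pi / (4 * 1)" using k by (intro divide_left_mono) auto
  moreover have "0 < pi / (4 * real k)" using k by simp
  ultimately have \<phi>: "0 < \<phi>" "\<phi> < 2 * \<phi>" "2 * \<phi> < pi"
    unfolding \<phi>_def using pi_gt_zero by linarith+
  obtain r0 where r0: "r0 > 0" "sector v (2 * \<phi>) r0 \<subseteq> V"
  proof -
    have "0 < pi / (2 * real k)" "pi / (2 * real k) < pi / real k" "pi / real k - pi / (2 * real k) = 2 * \<phi>"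
      using k pi_gt_zero by (auto simp: \<phi>_def field_simps)
    then show ?thesis using sectors that by metis
  qed
  obtain r1 where r1: "r1 > 0" "\<And>z (\<alpha>::real) (\<rho>::real) n. z = v * of_real \<rho> * cis \<alpha> \<Longrightarrow> \<rho> > 0 \<Longrightarrow> norm z < r1 \<Longrightarrow>
      \<bar>\<alpha>\<bar> \<le> \<phi> \<Longrightarrow> norm ((f ^^ n) z) \<le> norm z"
    using parabolic_orbit_on_ray[OF f v] unfolding \<phi>_def by metis
  obtain r2 c2 where r2: "r2 > 0" "c2 > 0"
    "\<And>z (\<rho>::real). z = v * of_real \<rho> * cis \<phi> \<Longrightarrow> \<rho> > 0 \<Longrightarrow> norm z < r2 \<Longrightarrow>
      (\<lambda>n. (f ^^ n) z) \<longlonglongrightarrow> 0 \<Longrightarrow> c2 \<le> - Im (directed_area f \<epsilon> z / z)"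
  by (rule Im_directed_area_quot_ge[OF f v, of 1 \<epsilon>]) (use assms(2) that in \<open>auto simp: \<phi>_def\<close>)
  obtain r3 c3 where r3: "r3 > 0" "c3 > 0"
    "\<And>z (\<rho>::real). z = v * of_real \<rho> * cis (- \<phi>) \<Longrightarrow> \<rho> > 0 \<Longrightarrow> norm z < r3 \<Longrightarrow>
      (\<lambda>n. (f ^^ n) z) \<longlonglongrightarrow> 0 \<Longrightarrow> c3 \<le> Im (directed_area f \<epsilon> z / z)"
  by (rule Im_directed_area_quot_ge[OF f v, of "- 1" \<epsilon>]) (use assms(2) that in \<open>auto simp: \<phi>_def\<close>)
  \<comment> \<open>Besides the radii from the dynamics, \<open>\<epsilon>\<close> enters because
    the upper bound for the moment needs orbits in a disc of radius at most
    \<open>\<epsilon>\<close>.\<close>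
  define r where "r = Min {r0, r1, r2, r3, \<epsilon>}"
  have r: "r > 0" "r \<le> r0" "r \<le> r1" "r \<le> r2" "r \<le> r3" "r \<le> \<epsilon>"
    unfolding r_def using r0 r1 r2 r3 assms(2) by auto
  define B where "B = ln (r / norm v)"
  let ?z = "\<lambda>s. v * exp s"
  define G where "G = (\<lambda>s. directed_area f \<epsilon> (?z s) / ?z s)"
  have z_eq: "?z s = v * of_real (exp (Re s)) * cis (Im s)" for s by (simp add: exp_eq_polar exp_of_real)
  have norm_z: "norm (?z s) < r" if "Re s < B" for s
  proof -
    have "exp (Re s) < r / norm v" using that r v0 by (metis B_def divide_pos_pos exp_less_mono exp_ln zero_less_norm_iff)
    then show ?thesis using v0 by (simp add: norm_mult field_simps)
  qed
  have zV: "?z s \<in> V" if "Re s < B" "\<bar>Im s\<bar> < 2 * \<phi>" for s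
  proof -
    have "Arg (?z s / v) = Im s" using that \<phi> v0 by (simp add: Arg_exp abs_less_iff)
    then have "?z s \<in> sector v (2 * \<phi>) r0"
      using norm_z[OF that(1)] r that v0 by (simp add: sector_def)
    then show ?thesis using r0 by blast
  qed
  have holG: "G holomorphic_on {s. Re s < B \<and> \<bar>Im s\<bar> < 2 * \<phi>}"
  proof -
    have "(directed_area f \<epsilon> \<circ> ?z) holomorphic_on {s. Re s < B \<and> \<bar>Im s\<bar> < 2 * \<phi>}"
      using zV by (intro holomorphic_on_compose_gen[OF _ hol] holomorphic_intros) auto
    then show ?thesis unfolding G_def o_def using v0 by (intro holomorphic_intros) auto
  qed
  have "\<not> G holomorphic_on {s. Re s < B \<and> \<bar>Im s\<bar> < 2 * \<phi>}"
  proof (rule not_holomorphic_half_strip[OF \<phi>(1,2), of "min c2 c3" B _ "8 * pi * \<epsilon>\<^sup>2"])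
    show "min c2 c3 > 0" using r2 r3 by simp
  next
    fix s assume s: "Re s < B" "\<bar>Im s\<bar> \<le> \<phi>"
    have "orbit_of f (?z s) \<subseteq> cball 0 (norm (?z s))"
      using r1(2)[OF z_eq, of s] norm_z[OF s(1)] r s by (auto simp: orbit_of_def)
    then have "norm (directed_area f \<epsilon> (?z s)) \<le> 8 * pi * \<epsilon>\<^sup>2 * norm (?z s)"
      using assms(2) norm_z[OF s(1)] r
      by (subst directed_area_eq_moment[where t="norm (?z s)"])
         (auto intro!: norm_set_integral_eps_nbhd_le simp: orbit_of_def)
    then show "norm (G s) \<le> 8 * pi * \<epsilon>\<^sup>2"
      using v0 unfolding G_def norm_divide by (subst pos_divide_le_eq) auto
  next
    fix x assume x: "x < B"
    have "c2 \<le> - Im (G (Complex x \<phi>))" unfolding G_def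
    proof (rule r2(3)[where \<rho> = "exp x"])
      show "?z (Complex x \<phi>) = v * of_real (exp x) * cis \<phi>" using z_eq[of "Complex x \<phi>"] by (simp only: complex.sel)
      show "norm (?z (Complex x \<phi>)) < r2" using norm_z[of "Complex x \<phi>"] x r by simp
    qed (use lim[OF zV[of "Complex x \<phi>"]] x \<phi> in auto)
    then show "min c2 c3 \<le> - Im (G (Complex x \<phi>))" by simp
    have "c3 \<le> Im (G (Complex x (- \<phi>)))" unfolding G_def
    proof (rule r3(3)[where \<rho> = "exp x"])
      show "?z (Complex x (- \<phi>)) = v * of_real (exp x) * cis (- \<phi>)"
        using z_eq[of "Complex x (- \<phi>)"] by (simp only: complex.sel)
      show "norm (?z (Complex x (- \<phi>))) < r3" using norm_z[of "Complex x (- \<phi>)"] x r by simp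
    qed (use lim[OF zV[of "Complex x (- \<phi>)"]] x \<phi> in auto)
    then show "min c2 c3 \<le> Im (G (Complex x (- \<phi>)))" by simp
  qed
  then show False using holG by blast
qed

theorem proposition5:
  fixes f :: "complex \<Rightarrow> complex" and U :: "complex set"
    and k :: nat and a1 a2 :: complex and \<epsilon> :: real
  assumes "germ_on U f"
    and "k \<ge> 1" and "a1 \<noteq> 0"
    and "(\<lambda>z. f z - (z + a1 * z ^ (k + 1) + a2 * z ^ (k + 2))) \<in> o[at 0](\<lambda>z. z ^ (k + 2))"
    and "\<epsilon> > 0"
  shows "(\<forall>V. attracting_petal U f V \<longrightarrow> \<not> (\<lambda>z. directed_area f \<epsilon> z) holomorphic_on V) \<and>
         (\<forall>W g V. repelling_petal W g f V \<longrightarrow> \<not> (\<lambda>z. directed_area g \<epsilon> z) holomorphic_on V)"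
  \<comment> \<open>A repelling petal is by definition an attracting petal of the representative
    \<open>g\<close> of the inverse germ, so one lemma covers both halves.\<close>
  using directed_area_not_holomorphic[OF _ assms(5)] by (auto simp: repelling_petal_def)

end
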